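(* Let $q\geq 3$ be a fixed integer and fix $\lambda\in(\lambda_s,\lambda_S)$. For each $n$, let $\beta=\beta_n>0$ be defined by $\lambda/n=1-e^{-\beta/n}$, and consider the Swendsen--Wang dynamics for the $q$-state mean-field Potts model on $n$ vertices at inverse temperature $\beta$. Then there exists $c=c(\lambda,q)>0$ such that for all sufficiently large $n$, the mixing time satisfies $t_{\textsc{mix}}\geq \exp(cn)$.
   Context: The mean-field $q$-state Potts model on $n$ vertices with parameter $\beta$ is the probability measure on $\{1,\dots,q\}^n$ given by $\mu(\sigma)\propto \exp\big(\tfrac{\beta}{n}\sum_{1\le i<j\le n}\mathbf 1\{\sigma_i=\sigma_j\}\big)$. For $q>2$ define $\lambda_s=\min_{z\geq 0}\{z+\frac{qz}{e^z-1}\}$ and $\lambda_S=q$ (one has $\lambda_s<\lambda_S$); in the $\beta$-parametrization these are the critical values $\beta_s,\beta_S$. Swendsen--Wang dynamics with $p=1-e^{-\beta/n}=\lambda/n$ is the Markov chain on $\{1,\dots,q\}^n$ which from $\sigma$ moves as follows: (1) letting $V_i=\{x:\sigma_x=i\}$, independently for each $i$ include each edge $xy$ with $x,y\in V_i$ independently with probability $p$ (no edges between different $V_i$), giving an edge configuration $\omega$ on the complete graph; (2) assign to each connected component of $\omega$ (isolated vertices included) an independent uniform color in $\{1,\dots,q\}$, and let $\sigma'_x$ be the color of the component of $x$. For a Markov chain with transition matrix $P$ and stationary distribution $\pi$ on a finite space $\Omega$, $t_{\textsc{mix}}=\inf\{t:\max_{X_0\in\Omega}\|P^t(X_0,\cdot)-\pi\|_{\mathrm{TV}}<1/(2e)\}$,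 where $\|\nu-\pi\|_{\mathrm{TV}}=\sup_{A\subset\Omega}|\nu(A)-\pi(A)|$. *)

theory Defs
  imports "HOL-Analysis.Analysis" "HOL-Library.Extended_Real"
begin

text \<open>Configurations on vertices 0..n-1 with colours 0..q-1 (extensional).\<close>
definition configs :: "nat \<Rightarrow> nat \<Rightarrow> (nat \<Rightarrow> nat) set" where
  "configs n q = PiE {0..<n} (\<lambda>_. {0..<q})"

text \<open>Mean-field Potts measure with parameter beta.\<close>
definition potts_weight :: "nat \<Rightarrow> real \<Rightarrow> (nat \<Rightarrow> nat) \<Rightarrow> real" where
  "potts_weight n \<beta> \<sigma> =
     exp (\<beta> / real n * real (card {(i,j). i < j \<and> j < n \<and> \<sigma> i = \<sigma> j}))"

definition potts :: "nat \<Rightarrow> nat \<Rightarrow> real \<Rightarrow> (nat \<Rightarrow> nat) \<Rightarrow> real" where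
  "potts n q \<beta> \<sigma> =
     (if \<sigma> \<in> configs n q
      then potts_weight n \<beta> \<sigma> / (\<Sum>\<tau>\<in>configs n q. potts_weight n \<beta> \<tau>) else 0)"

text \<open>Edges (x,y), x<y<n, inside a colour class of sigma.\<close>
definition allowed_edges :: "nat \<Rightarrow> (nat \<Rightarrow> nat) \<Rightarrow> (nat \<times> nat) set" where
  "allowed_edges n \<sigma> = {(x,y). x < y \<and> y < n \<and> \<sigma> x = \<sigma> y}"

text \<open>Number of connected components (isolated vertices included) of edge set omega on 0..n-1.\<close>
definition num_components :: "nat \<Rightarrow> (nat \<times> nat) set \<Rightarrow> nat" where
  "num_components n \<omega> = card ({0..<n} // Restr ((\<omega> \<union> \<omega>\<inverse>)\<^sup>*) {0..<n})"

text \<open>Swendsen--Wang transition probability from sigma to tau with edge probability p: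
  sum over percolation configurations omega on the colour classes of sigma, then each component
  gets an independent uniform colour (tau must be constant on components of omega).\<close>
definition sw_kernel :: "nat \<Rightarrow> nat \<Rightarrow> real \<Rightarrow> (nat \<Rightarrow> nat) \<Rightarrow> (nat \<Rightarrow> nat) \<Rightarrow> real" where
  "sw_kernel n q p \<sigma> \<tau> =
     (\<Sum>\<omega>\<in>Pow (allowed_edges n \<sigma>).
        p ^ card \<omega> * (1 - p) ^ (card (allowed_edges n \<sigma>) - card \<omega>) *
        (if \<tau> \<in> configs n q \<and> (\<forall>(x,y)\<in>\<omega>. \<tau> x = \<tau> y)
         then (1 / real q) ^ num_components n \<omega> else 0))"

text \<open>t-step transition probabilities P^t on the state space S.\<close>
fun mat_pow :: "'a set \<Rightarrow> ('a \<Rightarrow> 'a \<Rightarrow> real) \<Rightarrow> nat \<Rightarrow> 'a \<Rightarrow> 'a \<Rightarrow> real" where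
  "mat_pow S P 0 x y = (if x = y then 1 else 0)"
| "mat_pow S P (Suc t) x y = (\<Sum>z\<in>S. mat_pow S P t x z * P z y)"

text \<open>Total variation distance sup_A |nu(A) - pi(A)| on a finite space S.\<close>
definition tv_dist :: "'a set \<Rightarrow> ('a \<Rightarrow> real) \<Rightarrow> ('a \<Rightarrow> real) \<Rightarrow> real" where
  "tv_dist S \<nu> \<pi> = Max {\<bar>(\<Sum>x\<in>A. \<nu> x) - (\<Sum>x\<in>A. \<pi> x)\<bar> | A. A \<subseteq> S}"

text \<open>Mixing time (infinity if the set below is empty).\<close>
definition mixing_time :: "'a set \<Rightarrow> ('a \<Rightarrow> 'a \<Rightarrow> real) \<Rightarrow> ('a \<Rightarrow> real) \<Rightarrow> enat" where
  "mixing_time S P \<pi> =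
     (INF t \<in> {t. \<forall>x\<in>S. tv_dist S (mat_pow S P t x) \<pi> < 1 / (2 * exp 1)}. enat t)"

text \<open>lambda_s = min over z \<ge> 0 of z + q z/(e^z - 1); the value at z = 0 is the limit q, and
  since the minimum is < q it equals the infimum over z > 0.\<close>
definition lambda_s :: "nat \<Rightarrow> real" where
  "lambda_s q = (INF z \<in> {0<..}. z + real q * z / (exp z - 1))"

definition lambda_S :: "nat \<Rightarrow> real" where
  "lambda_S q = real q"

text \<open>beta_n defined by lambda/n = 1 - exp(-beta/n).\<close>
definition beta_of :: "real \<Rightarrow> nat \<Rightarrow> real" where
  "beta_of lam n = - real n * ln (1 - lam / real n)"

end

theory Submission
  imports Defs
begin

text \<open>For \<open>\<lambda>\<^sub>s < \<lambda> < \<lambda>\<^sub>S\<close> the dynamics has two disjoint traps, each left in one step with probability at most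
  \<open>exp (- c n)\<close>: the configurations all of whose colour classes have about \<open>n / q\<close> vertices, and those in which all
  classes except one are small. Each of the traps, used as starting point, forces the stationary measure to
  put more than half of its mass on it as long as the number of steps is below \<open>exp (c n)\<close>.

  The one-step estimates come from exploring one component after the other. Let \<open>C k t\<close> be the probability that
  the component of a given vertex has size \<open>t\<close> in the random graph on \<open>k\<close> vertices with edge density \<open>1 - r\<close>. All that
  is needed about it are the identities \<open>\<Sum>t. C k t = 1\<close> and \<open>C (k + 1) t (k + 1 - t) = C k t k r\<^sup>t\<close>. Comparing \<open>k\<close>
  with \<open>k + \<epsilon> n\<close> in the subcritical and with \<open>k - \<epsilon> n\<close> in the supercritical case, they give
  exponential decay in \<open>t\<close>, in the latter case for all components but a giant one. Exponential moments of the numbers of vertices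
  of each colour then follow by induction on the explored part.\<close>

section \<open>Components of percolation\<close>

text \<open>With \<open>r = 1 - lam / n\<close>, \<open>x = lam * k / n\<close> and
  \<open>w = lam * t / n\<close>, the ratio of \<open>C (k + 1) t\<close> to \<open>C k t\<close>
  is, up to lower order, above 1 when \<open>w > x * (1 - exp (- w))\<close> and below 1 when
  \<open>w < x * (1 - exp (- w))\<close>. The fixed-point equation of the giant thus separates the
  two comparisons, and for x < 1 only the first case occurs. One step contributes an exponent of
  order t / n, so order n steps produce a factor exponential in t. This takes the place of a
  branching process or a law of large numbers for the giant: a lower bound
  \<open>v * n / lam\<close> on its size suffices, since a larger giant leaves fewer vertices to the
  other colours.

  The two ends of the interval enter separately. \<open>lam < q\<close> makes room for a bound b
  with \<open>1 / q < b\<close> and \<open>lam * b < 1\<close>, so that balanced classes are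
  subcritical and stay balanced. \<open>lambda_s q < lam\<close> supplies v with
  \<open>v + q * v / (exp v - 1) < lam\<close>, so that a dominant class, after its giant is
  recoloured and the rest is spread evenly, has room to spare.\<close>

definition comp_of :: "('a \<times> 'a) set \<Rightarrow> 'a \<Rightarrow> 'a set" where
  "comp_of w v = ((w \<union> w\<inverse>)\<^sup>*) `` {v}"

definition perc_wt :: "real \<Rightarrow> 'e set \<Rightarrow> 'e set \<Rightarrow> real" where
  "perc_wt p E w = p ^ card w * (1 - p) ^ (card E - card w)"

definition comp_count :: "'a set \<Rightarrow> ('a \<times> 'a) set \<Rightarrow> nat" where
  "comp_count V w = card (comp_of w ` V)"

text \<open>An edge is stored as a single ordered pair, which may point either way between the two
  sets; hence both products.\<close>

definition cross :: "('a \<times> 'a) set \<Rightarrow> 'a set \<Rightarrow> 'a set \<Rightarrow> ('a \<times> 'a) set" where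
  "cross E S T = E \<inter> (S \<times> T \<union> T \<times> S)"

lemma sum_perc_wt:
  assumes "finite E"
  shows "(\<Sum>w\<in>Pow E. perc_wt p E w) = 1"
proof -
  have "(\<Sum>w\<in>Pow E. perc_wt p E w) = (\<Sum>w\<in>Pow E. (\<Prod>x\<in>w. p) * (\<Prod>x\<in>E - w. 1 - p))"
    using assms by (intro sum.cong refl) (auto simp: perc_wt_def card_Diff_subset finite_subset)
  also have "\<dots> = (\<Prod>x\<in>E. p + (1 - p))"
    by (rule prod_add[OF assms, symmetric])
  finally show ?thesis by simp
qed

lemma perc_wt_nonneg: "0 \<le> p \<Longrightarrow> p \<le> 1 \<Longrightarrow> 0 \<le> perc_wt p E w"
  by (simp add: perc_wt_def)

lemma comp_of_self: "v \<in> comp_of w v"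
  by (simp add: comp_of_def)

lemma comp_of_mono: "w \<subseteq> w' \<Longrightarrow> comp_of w v \<subseteq> comp_of w' v"
  unfolding comp_of_def by (intro Image_mono rtrancl_mono) auto

lemma comp_of_closed: "(x, y) \<in> w \<Longrightarrow> x \<in> comp_of w v \<longleftrightarrow> y \<in> comp_of w v"
  unfolding comp_of_def by (auto intro: rtrancl_into_rtrancl)

text \<open>Induction along paths. It is applied to membership in a vertex set and to having the
  colour of the root.\<close>

lemma comp_of_invariant:
  assumes "\<And>x y. (x, y) \<in> w \<Longrightarrow> P x \<longleftrightarrow> P y" "P v" "y \<in> comp_of w v"
  shows "P y"
proof -
  have "(v, y) \<in> (w \<union> w\<inverse>)\<^sup>*" using assms(3) by (simp add: comp_of_def)
  then show ?thesis by (induction rule: rtrancl_induct) (use assms in auto)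
qed

lemma comp_of_subset: "w \<subseteq> V \<times> V \<Longrightarrow> v \<in> V \<Longrightarrow> comp_of w v \<subseteq> V"
  using comp_of_invariant[of w "\<lambda>x. x \<in> V" v] by blast

text \<open>No path starting in S leaves S, so the edges elsewhere cannot influence the
  component.\<close>

lemma comp_of_local:
  assumes cl: "\<And>x y. (x, y) \<in> w \<Longrightarrow> x \<in> S \<longleftrightarrow> y \<in> S" and v: "v \<in> S"
  shows "comp_of w v = comp_of (w \<inter> S \<times> S) v"
proof
  show "comp_of (w \<inter> S \<times> S) v \<subseteq> comp_of w v" by (rule comp_of_mono) auto
  show "comp_of w v \<subseteq> comp_of (w \<inter> S \<times> S) v"
  proof
    fix y assume "y \<in> comp_of w v"
    then have "(v, y) \<in> (w \<union> w\<inverse>)\<^sup>*" by (simp add: comp_of_def)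
    then have "y \<in> S \<and> y \<in> comp_of (w \<inter> S \<times> S) v"
    proof (induction rule: rtrancl_induct)
      case base then show ?case by (simp add: v comp_of_self)
    next
      case (step y z)
      then have "(y, z) \<in> w \<inter> S \<times> S \<or> (z, y) \<in> w \<inter> S \<times> S" using cl by blast
      with step.IH show ?case
        using comp_of_closed[of _ _ "w \<inter> S \<times> S" v] by blast
    qed
    then show "y \<in> comp_of (w \<inter> S \<times> S) v" ..
  qed
qed

lemma comp_of_eq: "y \<in> comp_of w v \<Longrightarrow> comp_of w y = comp_of w v"
proof -
  have s: "sym ((w \<union> w\<inverse>)\<^sup>*)" by (intro sym_rtrancl sym_Un_converse)
  assume "y \<in> comp_of w v"
  then have a: "(v, y) \<in> (w \<union> w\<inverse>)\<^sup>*" by (simp add: comp_of_def)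
  then have "(y, v) \<in> (w \<union> w\<inverse>)\<^sup>*" using s by (auto dest: symD)
  with a show ?thesis unfolding comp_of_def by (auto intro: rtrancl_trans)
qed

lemma num_components_eq:
  assumes "w \<subseteq> {0..<n} \<times> {0..<n}"
  shows "num_components n w = comp_count {0..<n} w"
proof -
  have "{0..<n} // Restr ((w \<union> w\<inverse>)\<^sup>*) {0..<n} = comp_of w ` {0..<n}"
  proof -
    have *: "Restr ((w \<union> w\<inverse>)\<^sup>*) {0..<n} `` {x} = comp_of w x" if "x \<in> {0..<n}" for x
      using comp_of_subset[OF assms that] that by (auto simp: comp_of_def)
    show ?thesis unfolding quotient_def using * by (auto simp: image_def)
  qed
  then show ?thesis by (simp add: num_components_def comp_count_def)
qed

text \<open>If the component of v is S, no edge between S and the rest is open. So w splits into a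
  part a that connects S and an arbitrary part b on the complement, while the closed crossing edges
  contribute the power of 1 - p. This independence is what allows exploration of one component after
  the other.\<close>

lemma sum_component_eq:
  fixes p :: real and F :: "('a \<times> 'a) set \<Rightarrow> real"
  assumes V: "finite V" "S \<subseteq> V" "v \<in> S"
  shows "(\<Sum>w\<in>{w \<in> Pow (E \<inter> V \<times> V). comp_of w v = S}. perc_wt p (E \<inter> V \<times> V) w * F w)
    = (\<Sum>(a, b)\<in>{a \<in> Pow (E \<inter> S \<times> S). comp_of a v = S} \<times> Pow (E \<inter> (V - S) \<times> (V - S)).
        perc_wt p (E \<inter> S \<times> S) a * (1 - p) ^ card (cross E S (V - S)) *
        (perc_wt p (E \<inter> (V - S) \<times> (V - S)) b * F (a \<union> b)))" (is "sum ?f ?L = sum ?g ?R")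
proof (rule sum.reindex_bij_witness[where j = "\<lambda>w. (w \<inter> S \<times> S, w \<inter> (V - S) \<times> (V - S))"
      and i = "\<lambda>(a, b). a \<union> b"])
  have fin: "finite (E \<inter> X \<times> Y)" if "X \<subseteq> V" "Y \<subseteq> V" for X Y
    using that V(1) by (meson finite_Int finite_SigmaI finite_subset)
  {
    fix w assume w: "w \<in> ?L"
    have cl: "x \<in> S \<longleftrightarrow> y \<in> S" if "(x, y) \<in> w" for x y
      using comp_of_closed[OF that, of v] w by auto
    then show eq: "(case (w \<inter> S \<times> S, w \<inter> (V - S) \<times> (V - S)) of (a, b) \<Rightarrow> a \<union> b) = w"
      using w by auto
    have "comp_of (w \<inter> S \<times> S) v = S"
      using comp_of_local[of w S v, OF cl V(3)] w by simp
    then show "(w \<inter> S \<times> S, w \<inter> (V - S) \<times> (V - S)) \<in> ?R" using w by auto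
    let ?a = "w \<inter> S \<times> S" and ?b = "w \<inter> (V - S) \<times> (V - S)"
    have un: "w = ?a \<union> ?b" using eq by simp
    have sub: "?a \<subseteq> E \<inter> S \<times> S" "?b \<subseteq> E \<inter> (V - S) \<times> (V - S)" using w by auto
    have fab: "finite (E \<inter> S \<times> S)" "finite (E \<inter> (V - S) \<times> (V - S))" "finite (cross E S (V - S))"
      using fin[of S S] fin[of "V - S" "V - S"] fin[of S "V - S"] fin[of "V - S" S] V(2)
      by (auto simp: cross_def Int_Un_distrib)
    have "card w = card (?a \<union> ?b)" using un by simp
    also have "\<dots> = card ?a + card ?b"
      using finite_subset[OF sub(1) fab(1)] finite_subset[OF sub(2) fab(2)] by (intro card_Un_disjoint) auto
    finally have cw: "card w = card ?a + card ?b" .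
    have "E \<inter> V \<times> V = (E \<inter> S \<times> S \<union> E \<inter> (V - S) \<times> (V - S)) \<union> cross E S (V - S)"
      using V(2) by (auto simp: cross_def)
    then have "card (E \<inter> V \<times> V) = card ((E \<inter> S \<times> S \<union> E \<inter> (V - S) \<times> (V - S)) \<union> cross E S (V - S))"
      by simp
    also have "\<dots> = card (E \<inter> S \<times> S \<union> E \<inter> (V - S) \<times> (V - S)) + card (cross E S (V - S))"
      using fab by (intro card_Un_disjoint) (auto simp: cross_def)
    also have "card (E \<inter> S \<times> S \<union> E \<inter> (V - S) \<times> (V - S)) = card (E \<inter> S \<times> S) + card (E \<inter> (V - S) \<times> (V - S))"
      using fab by (intro card_Un_disjoint) auto
    finally have cE: "card (E \<inter> V \<times> V) = card (E \<inter> S \<times> S) + card (E \<inter> (V - S) \<times> (V - S)) + card (cross E S (V - S))" .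
    have le: "card ?a \<le> card (E \<inter> S \<times> S)" "card ?b \<le> card (E \<inter> (V - S) \<times> (V - S))"
      using sub fab by (auto intro: card_mono)
    have "card (E \<inter> V \<times> V) - card w = (card (E \<inter> S \<times> S) - card ?a) + card (cross E S (V - S))
        + (card (E \<inter> (V - S) \<times> (V - S)) - card ?b)"
      using cE cw le by linarith
    then have "perc_wt p (E \<inter> V \<times> V) w = perc_wt p (E \<inter> S \<times> S) ?a * (1 - p) ^ card (cross E S (V - S)) *
        perc_wt p (E \<inter> (V - S) \<times> (V - S)) ?b"
      unfolding perc_wt_def by (simp add: cw power_add algebra_simps)
    then show "?g (w \<inter> S \<times> S, w \<inter> (V - S) \<times> (V - S)) = ?f w"
      using un by simp
  next
    fix ab assume ab: "ab \<in> ?R"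
    obtain a b where [simp]: "ab = (a, b)" by (cases ab)
    have a: "a \<subseteq> E \<inter> S \<times> S" "comp_of a v = S" and b: "b \<subseteq> E \<inter> (V - S) \<times> (V - S)" using ab by auto
    have "comp_of (a \<union> b) v = comp_of ((a \<union> b) \<inter> S \<times> S) v"
      using a b V by (intro comp_of_local) auto
    also have "(a \<union> b) \<inter> S \<times> S = a" using a b by auto
    finally have "comp_of (a \<union> b) v = S" using a by simp
    then show "(case ab of (a, b) \<Rightarrow> a \<union> b) \<in> ?L" using a b V(2) by auto
    show "((case ab of (a, b) \<Rightarrow> a \<union> b) \<inter> S \<times> S,
      (case ab of (a, b) \<Rightarrow> a \<union> b) \<inter> (V - S) \<times> (V - S)) = ab"
      using a b by auto
  }
qed

lemma sum_product_weighted: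
  fixes f :: "'a \<Rightarrow> real" and g :: "'b \<Rightarrow> real"
  shows "(\<Sum>(a, b)\<in>A \<times> B. f a * c * g b) = sum f A * c * sum g B"
proof -
  have "(\<Sum>(a, b)\<in>A \<times> B. f a * c * g b) = (\<Sum>a\<in>A. \<Sum>b\<in>B. f a * c * g b)"
    by (simp add: sum.cartesian_product)
  also have "\<dots> = sum f A * c * sum g B"
    by (simp add: sum_distrib_left[symmetric] sum_distrib_right[symmetric])
  finally show ?thesis .
qed

definition conn_prob :: "real \<Rightarrow> ('a \<times> 'a) set \<Rightarrow> 'a \<Rightarrow> 'a set \<Rightarrow> real" where
  "conn_prob p E v S = (\<Sum>w\<in>{w \<in> Pow (E \<inter> S \<times> S). comp_of w v = S}. perc_wt p (E \<inter> S \<times> S) w)"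

definition comp_prob :: "real \<Rightarrow> ('a \<times> 'a) set \<Rightarrow> 'a set \<Rightarrow> 'a \<Rightarrow> 'a set \<Rightarrow> real" where
  "comp_prob p E V v S = conn_prob p E v S * (1 - p) ^ card (cross E S (V - S))"

text \<open>The Swendsen-Wang transition probability with an arbitrary edge set, a variable vertex
  set and s in place of 1 / q. The vertex set has to vary because explored components are removed
  from it.\<close>

definition rc_kernel :: "real \<Rightarrow> real \<Rightarrow> ('a \<times> 'a) set \<Rightarrow> 'a set \<Rightarrow> ('a \<Rightarrow> 'b) \<Rightarrow> real" where
  "rc_kernel p s E V \<tau> = (\<Sum>w\<in>Pow (E \<inter> V \<times> V). perc_wt p (E \<inter> V \<times> V) w *
     (if \<forall>(x, y)\<in>w. \<tau> x = \<tau> y then s ^ comp_count V w else 0))"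

lemma sum_split_component:
  fixes p :: real and F :: "('a \<times> 'a) set \<Rightarrow> real"
  assumes V: "finite V" "v \<in> V"
  shows "(\<Sum>w\<in>Pow (E \<inter> V \<times> V). perc_wt p (E \<inter> V \<times> V) w * F w)
    = (\<Sum>S | S \<subseteq> V \<and> v \<in> S. \<Sum>(a, b)\<in>{a \<in> Pow (E \<inter> S \<times> S). comp_of a v = S} \<times> Pow (E \<inter> (V - S) \<times> (V - S)).
        perc_wt p (E \<inter> S \<times> S) a * (1 - p) ^ card (cross E S (V - S)) *
        (perc_wt p (E \<inter> (V - S) \<times> (V - S)) b * F (a \<union> b)))"
proof -
  have f: "finite (E \<inter> V \<times> V)" using V by simp
  have "(\<Sum>w\<in>Pow (E \<inter> V \<times> V). perc_wt p (E \<inter> V \<times> V) w * F w)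
     = (\<Sum>S | S \<subseteq> V \<and> v \<in> S. \<Sum>w | w \<in> Pow (E \<inter> V \<times> V) \<and> comp_of w v = S. perc_wt p (E \<inter> V \<times> V) w * F w)"
  proof (rule sum.group[symmetric])
    show "finite (Pow (E \<inter> V \<times> V))" using f by (simp only: finite_Pow_iff)
    show "finite {S. S \<subseteq> V \<and> v \<in> S}" using V by (auto intro: finite_subset[of _ "Pow V"])
    show "(\<lambda>w. comp_of w v) ` Pow (E \<inter> V \<times> V) \<subseteq> {S. S \<subseteq> V \<and> v \<in> S}"
    proof (rule image_subsetI)
      fix w assume "w \<in> Pow (E \<inter> V \<times> V)"
      then have "w \<subseteq> V \<times> V" by simp
      from comp_of_subset[OF this V(2)] show "comp_of w v \<in> {S. S \<subseteq> V \<and> v \<in> S}"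
        by (simp add: comp_of_self)
    qed
  qed
  also have "\<dots> = (\<Sum>S | S \<subseteq> V \<and> v \<in> S. \<Sum>(a, b)\<in>{a \<in> Pow (E \<inter> S \<times> S). comp_of a v = S} \<times> Pow (E \<inter> (V - S) \<times> (V - S)).
        perc_wt p (E \<inter> S \<times> S) a * (1 - p) ^ card (cross E S (V - S)) *
        (perc_wt p (E \<inter> (V - S) \<times> (V - S)) b * F (a \<union> b)))"
    by (intro sum.cong refl) (use sum_component_eq V in auto)
  finally show ?thesis .
qed

lemma sum_comp_prob:
  assumes V: "finite V" "v \<in> V"
  shows "(\<Sum>S | S \<subseteq> V \<and> v \<in> S. comp_prob p E V v S) = 1"
proof -
  have "1 = (\<Sum>w\<in>Pow (E \<inter> V \<times> V). perc_wt p (E \<inter> V \<times> V) w * 1)"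
    using sum_perc_wt[of "E \<inter> V \<times> V" p] V by simp
  also have "\<dots> = (\<Sum>S | S \<subseteq> V \<and> v \<in> S. comp_prob p E V v S)"
    unfolding sum_split_component[OF V]
  proof (intro sum.cong refl)
    fix S
    have "finite (E \<inter> (V - S) \<times> (V - S))" using V by auto
    note sum_perc_wt[OF this, of p]
    then show "(\<Sum>(a, b)\<in>{a \<in> Pow (E \<inter> S \<times> S). comp_of a v = S} \<times> Pow (E \<inter> (V - S) \<times> (V - S)).
        perc_wt p (E \<inter> S \<times> S) a * (1 - p) ^ card (cross E S (V - S)) *
        (perc_wt p (E \<inter> (V - S) \<times> (V - S)) b * 1)) = comp_prob p E V v S"
      by (simp add: sum_product_weighted comp_prob_def conn_prob_def)
  qed
  finally show ?thesis by simp
qed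

lemma comp_count_union:
  assumes "finite V" "S \<subseteq> V" "v \<in> S" "a \<subseteq> S \<times> S" "comp_of a v = S" "b \<subseteq> (V - S) \<times> (V - S)"
  shows "comp_count V (a \<union> b) = Suc (comp_count (V - S) b)"
proof -
  have 1: "comp_of (a \<union> b) x = S" if "x \<in> S" for x
  proof -
    have "comp_of (a \<union> b) x = comp_of ((a \<union> b) \<inter> S \<times> S) x"
      using assms that by (intro comp_of_local) auto
    also have "(a \<union> b) \<inter> S \<times> S = a" using assms by auto
    also have "comp_of a x = S" using comp_of_eq[of x a v] assms that by simp
    finally show ?thesis .
  qed
  have 2: "comp_of (a \<union> b) x = comp_of b x" if "x \<in> V - S" for x
  proof -
    have "comp_of (a \<union> b) x = comp_of ((a \<union> b) \<inter> (V - S) \<times> (V - S)) x"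
      using assms that by (intro comp_of_local) auto
    also have "(a \<union> b) \<inter> (V - S) \<times> (V - S) = b" using assms by auto
    finally show ?thesis .
  qed
  have "comp_of (a \<union> b) ` V = comp_of (a \<union> b) ` S \<union> comp_of (a \<union> b) ` (V - S)" using assms by auto
  also have "comp_of (a \<union> b) ` S = {S}" using 1 assms(3) by auto
  also have "comp_of (a \<union> b) ` (V - S) = comp_of b ` (V - S)" using 2 by (intro image_cong) auto
  finally have *: "comp_of (a \<union> b) ` V = insert S (comp_of b ` (V - S))" by simp
  have "S \<notin> comp_of b ` (V - S)"
  proof
    assume "S \<in> comp_of b ` (V - S)"
    then obtain x where "x \<in> V - S" "comp_of b x = S" by auto
    then show False using comp_of_self[of x b] by auto
  qed
  then show ?thesis unfolding comp_count_def * using assms(1) by simp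
qed

text \<open>One step of the exploration: the component S of v costs one factor s for its colour,
  forces the new colouring to be constant on S, and leaves an independent percolation on V -
  S.\<close>

lemma rc_kernel_rec:
  assumes V: "finite V" "v \<in> V"
  shows "rc_kernel p s E V \<tau> = (\<Sum>S | S \<subseteq> V \<and> v \<in> S. comp_prob p E V v S *
     (s * (if \<forall>x\<in>S. \<tau> x = \<tau> v then rc_kernel p s E (V - S) \<tau> else 0)))"
proof -
  define F where "F = (\<lambda>V w. if \<forall>(x, y)\<in>w. \<tau> x = \<tau> y then s ^ comp_count V w else 0)"
  have "rc_kernel p s E V \<tau> = (\<Sum>w\<in>Pow (E \<inter> V \<times> V). perc_wt p (E \<inter> V \<times> V) w * F V w)"
    by (simp add: rc_kernel_def F_def)
  also have "\<dots> = (\<Sum>S | S \<subseteq> V \<and> v \<in> S. comp_prob p E V v S *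
     (s * (if \<forall>x\<in>S. \<tau> x = \<tau> v then rc_kernel p s E (V - S) \<tau> else 0)))"
    unfolding sum_split_component[OF V]
  proof (intro sum.cong refl)
    fix S assume "S \<in> {S. S \<subseteq> V \<and> v \<in> S}"
    then have S: "S \<subseteq> V" "v \<in> S" by auto
    have FF: "F V (a \<union> b) = s * ((if \<forall>x\<in>S. \<tau> x = \<tau> v then 1 else 0) * F (V - S) b)"
      if "a \<subseteq> S \<times> S" "comp_of a v = S" "b \<subseteq> (V - S) \<times> (V - S)" for a b
    proof -
      \<comment> \<open>Agreement along the edges of a is agreement with v on all of S, because a
        connects S.\<close>
      have "(\<forall>(x, y)\<in>a. \<tau> x = \<tau> y) \<longleftrightarrow> (\<forall>x\<in>S. \<tau> x = \<tau> v)"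
      proof
        assume *: "\<forall>(x, y)\<in>a. \<tau> x = \<tau> y"
        show "\<forall>x\<in>S. \<tau> x = \<tau> v"
        proof
          fix x assume "x \<in> S"
          then have x: "x \<in> comp_of a v" using that(2) by simp
          show "\<tau> x = \<tau> v"
          proof (rule comp_of_invariant[of a "\<lambda>x. \<tau> x = \<tau> v" v x])
            fix y z assume "(y, z) \<in> a"
            with * have "\<tau> y = \<tau> z" by blast
            then show "\<tau> y = \<tau> v \<longleftrightarrow> \<tau> z = \<tau> v" by simp
          qed (use x in auto)
        qed
      next
        assume *: "\<forall>x\<in>S. \<tau> x = \<tau> v"
        show "\<forall>(x, y)\<in>a. \<tau> x = \<tau> y"
        proof clarify
          fix x y assume "(x, y) \<in> a"
          then have "x \<in> S" "y \<in> S" using that(1) by auto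
          then show "\<tau> x = \<tau> y" using * by simp
        qed
      qed
      moreover have "(\<forall>(x, y)\<in>a \<union> b. \<tau> x = \<tau> y) \<longleftrightarrow> (\<forall>(x, y)\<in>a. \<tau> x = \<tau> y) \<and> (\<forall>(x, y)\<in>b. \<tau> x = \<tau> y)"
        by (rule ball_Un)
      ultimately show ?thesis unfolding F_def comp_count_union[OF V(1) S that] by simp
    qed
    have "(\<Sum>(a, b)\<in>{a \<in> Pow (E \<inter> S \<times> S). comp_of a v = S} \<times> Pow (E \<inter> (V - S) \<times> (V - S)).
        perc_wt p (E \<inter> S \<times> S) a * (1 - p) ^ card (cross E S (V - S)) *
        (perc_wt p (E \<inter> (V - S) \<times> (V - S)) b * F V (a \<union> b)))
      = (\<Sum>(a, b)\<in>{a \<in> Pow (E \<inter> S \<times> S). comp_of a v = S} \<times> Pow (E \<inter> (V - S) \<times> (V - S)).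
        perc_wt p (E \<inter> S \<times> S) a * ((1 - p) ^ card (cross E S (V - S)) *
        (s * (if \<forall>x\<in>S. \<tau> x = \<tau> v then 1 else 0))) * (perc_wt p (E \<inter> (V - S) \<times> (V - S)) b * F (V - S) b))"
    proof (rule sum.cong[OF refl], goal_cases)
      case (1 ab)
      then obtain a b where ab_eq: "ab = (a, b)"
        and ab: "comp_of a v = S" "a \<subseteq> E \<inter> S \<times> S" "b \<subseteq> E \<inter> (V - S) \<times> (V - S)" by auto
      have "F V (a \<union> b) = s * ((if \<forall>x\<in>S. \<tau> x = \<tau> v then 1 else 0) * F (V - S) b)"
        by (rule FF) (use ab in auto)
      then show ?case unfolding ab_eq case_prod_conv
        by (simp only: mult_ac)
    qed
    also have "\<dots> = conn_prob p E v S * ((1 - p) ^ card (cross E S (V - S)) *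
        (s * (if \<forall>x\<in>S. \<tau> x = \<tau> v then 1 else 0))) * rc_kernel p s E (V - S) \<tau>"
      unfolding sum_product_weighted conn_prob_def rc_kernel_def F_def by (rule refl)
    also have "\<dots> = comp_prob p E V v S * (s * (if \<forall>x\<in>S. \<tau> x = \<tau> v then rc_kernel p s E (V - S) \<tau> else 0))"
      unfolding comp_prob_def by simp
    finally show "(\<Sum>(a, b)\<in>{a \<in> Pow (E \<inter> S \<times> S). comp_of a v = S} \<times> Pow (E \<inter> (V - S) \<times> (V - S)).
        perc_wt p (E \<inter> S \<times> S) a * (1 - p) ^ card (cross E S (V - S)) *
        (perc_wt p (E \<inter> (V - S) \<times> (V - S)) b * F V (a \<union> b))) =
        comp_prob p E V v S * (s * (if \<forall>x\<in>S. \<tau> x = \<tau> v then rc_kernel p s E (V - S) \<tau> else 0))" .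
  qed
  finally show ?thesis .
qed

lemma conn_prob_nonneg: "0 \<le> p \<Longrightarrow> p \<le> 1 \<Longrightarrow> 0 \<le> conn_prob p E v S"
  unfolding conn_prob_def by (intro sum_nonneg perc_wt_nonneg)

lemma comp_prob_nonneg: "0 \<le> p \<Longrightarrow> p \<le> 1 \<Longrightarrow> 0 \<le> comp_prob p E V v S"
  unfolding comp_prob_def by (simp add: conn_prob_nonneg)

lemma rc_kernel_nonneg: "0 \<le> p \<Longrightarrow> p \<le> 1 \<Longrightarrow> 0 \<le> s \<Longrightarrow> 0 \<le> rc_kernel p s E V \<tau>"
  unfolding rc_kernel_def by (intro sum_nonneg mult_nonneg_nonneg perc_wt_nonneg) auto

lemma rc_kernel_empty: "rc_kernel p s E {} \<tau> = 1"
  by (simp add: rc_kernel_def perc_wt_def comp_count_def)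

lemma sw_kernel_eq:
  assumes "\<tau> \<in> configs n q"
  shows "sw_kernel n q p \<sigma> \<tau> = rc_kernel p (1 / real q) (allowed_edges n \<sigma>) {0..<n} \<tau>"
proof -
  have *: "allowed_edges n \<sigma> \<inter> {0..<n} \<times> {0..<n} = allowed_edges n \<sigma>"
    by (auto simp: allowed_edges_def)
  have "num_components n w = comp_count {0..<n} w" if "w \<subseteq> allowed_edges n \<sigma>" for w
    using that by (intro num_components_eq) (auto simp: allowed_edges_def)
  then show ?thesis unfolding sw_kernel_def rc_kernel_def * perc_wt_def
    using assms by (intro sum.cong refl) auto
qed

section \<open>Component sizes in the random graph\<close>

text \<open>\<open>clique_conn r k\<close> is the probability that the random graph on \<open>k\<close> vertices whose edges are
  absent with probability \<open>r\<close> is connected, and \<open>clique_comp r k t\<close> the probability that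
  the component of a given vertex has size \<open>t\<close> in it. The defining equation of \<open>clique_conn\<close> says that the
  latter probabilities add up to 1.\<close>

function clique_conn :: "real \<Rightarrow> nat \<Rightarrow> real" where
  "clique_conn r k =
    1 - (\<Sum>t\<in>{1..<k}. real ((k - 1) choose (t - 1)) * clique_conn r t * r ^ (t * (k - t)))"
  by pat_completeness auto
termination by (relation "inv_image less_than snd") auto

declare clique_conn.simps [simp del]

definition clique_comp :: "real \<Rightarrow> nat \<Rightarrow> nat \<Rightarrow> real" where
  "clique_comp r k t = real ((k - 1) choose (t - 1)) * clique_conn r t * r ^ (t * (k - t))"

lemma sum_clique_comp:
  assumes "k \<ge> 1"
  shows "(\<Sum>t\<in>{1..k}. clique_comp r k t) = 1"
proof -
  have "{1..k} = insert k {1..<k}" using assms by auto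
  then have "(\<Sum>t\<in>{1..k}. clique_comp r k t) = clique_comp r k k + (\<Sum>t\<in>{1..<k}. clique_comp r k t)"
    by simp
  also have "clique_comp r k k = clique_conn r k" by (simp add: clique_comp_def)
  also have "\<dots> = 1 - (\<Sum>t\<in>{1..<k}. clique_comp r k t)"
    by (subst clique_conn.simps) (simp add: clique_comp_def)
  finally show ?thesis by simp
qed

lemma sum_subsets_by_card:
  fixes \<phi> :: "nat \<Rightarrow> real"
  assumes W: "finite W" "v \<in> W"
  shows "(\<Sum>S | S \<subseteq> W \<and> v \<in> S. \<phi> (card S)) =
    (\<Sum>t\<in>{1..card W}. real ((card W - 1) choose (t - 1)) * \<phi> t)"
proof -
  let ?A = "{S. S \<subseteq> W \<and> v \<in> S}"
  have finA: "finite ?A" using W by (auto intro: finite_subset[of _ "Pow W"])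
  have pos: "card S \<in> {1..card W}" if "S \<in> ?A" for S
  proof -
    have "finite S" "S \<noteq> {}" using that W finite_subset by auto
    then show ?thesis using that W card_mono[of W S] by (simp add: Suc_leI card_gt_0_iff)
  qed
  have "(\<Sum>S\<in>?A. \<phi> (card S)) = (\<Sum>t\<in>{1..card W}. \<Sum>S | S \<in> ?A \<and> card S = t. \<phi> (card S))"
    using finA pos by (intro sum.group[symmetric]) auto
  also have "\<dots> = (\<Sum>t\<in>{1..card W}. real ((card W - 1) choose (t - 1)) * \<phi> t)"
  proof (intro sum.cong refl)
    fix t assume t: "t \<in> {1..card W}"
    have "{S \<in> ?A. card S = t} = insert v ` {B. B \<subseteq> W - {v} \<and> card B = t - 1}"
    proof (intro equalityI subsetI)
      fix S assume S: "S \<in> {S \<in> ?A. card S = t}"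
      then have "finite S" using W finite_subset by auto
      then have "S = insert v (S - {v})" "S - {v} \<subseteq> W - {v}" "card (S - {v}) = t - 1" using S by auto
      then show "S \<in> insert v ` {B. B \<subseteq> W - {v} \<and> card B = t - 1}" by blast
    next
      fix S assume "S \<in> insert v ` {B. B \<subseteq> W - {v} \<and> card B = t - 1}"
      then obtain B where B: "S = insert v B" "B \<subseteq> W - {v}" "card B = t - 1" by auto
      then have "finite B" "v \<notin> B" using W finite_subset by auto
      then show "S \<in> {S \<in> ?A. card S = t}" using B W t by auto
    qed
    moreover have "inj_on (insert v) {B. B \<subseteq> W - {v} \<and> card B = t - 1}"
      by (rule inj_onI) (metis (no_types, lifting) Diff_insert_absorb mem_Collect_eq subset_Diff_insert)
    ultimately have "card {S \<in> ?A. card S = t} = card {B. B \<subseteq> W - {v} \<and> card B = t - 1}"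
      by (simp add: card_image)
    also have "\<dots> = (card W - 1) choose (t - 1)"
      using n_subsets[of "W - {v}" "t - 1"] W by simp
    finally have c: "card {S \<in> ?A. card S = t} = (card W - 1) choose (t - 1)" .
    have "(\<Sum>S | S \<in> ?A \<and> card S = t. \<phi> (card S)) = (\<Sum>S | S \<in> ?A \<and> card S = t. \<phi> t)"
      by (intro sum.cong) auto
    also have "\<dots> = real ((card W - 1) choose (t - 1)) * \<phi> t" using c by simp
    finally show "(\<Sum>S | S \<in> ?A \<and> card S = t. \<phi> (card S)) = real ((card W - 1) choose (t - 1)) * \<phi> t" .
  qed
  finally show ?thesis .
qed

lemma conn_prob_outside_class:
  assumes "\<not> (\<forall>x\<in>S. \<sigma> x = \<sigma> v)"
  shows "conn_prob p (allowed_edges n \<sigma>) v S = 0"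
proof -
  have "comp_of w v \<noteq> S" if "w \<subseteq> allowed_edges n \<sigma>" for w
  proof
    assume w: "comp_of w v = S"
    have "\<sigma> x = \<sigma> v" if "x \<in> S" for x
    proof (rule comp_of_invariant[of w "\<lambda>x. \<sigma> x = \<sigma> v" v x])
      fix y z assume "(y, z) \<in> w"
      then have "\<sigma> y = \<sigma> z" using \<open>w \<subseteq> allowed_edges n \<sigma>\<close> by (auto simp: allowed_edges_def)
      then show "\<sigma> y = \<sigma> v \<longleftrightarrow> \<sigma> z = \<sigma> v" by simp
    qed (use w that in auto)
    then show False using assms by blast
  qed
  then have "{w \<in> Pow (allowed_edges n \<sigma> \<inter> S \<times> S). comp_of w v = S} = {}" by auto
  then show ?thesis unfolding conn_prob_def by (simp only: sum.empty)
qed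

text \<open>Each pair of a vertex of S and a vertex of the same class outside S is one allowed edge,
  stored with the smaller endpoint first; \<open>?f\<close> performs this ordering.\<close>

lemma card_cross_class:
  assumes V: "V \<subseteq> {0..<n}" and S: "S \<subseteq> {x \<in> V. \<sigma> x = \<sigma> v}"
  shows "card (cross (allowed_edges n \<sigma>) S (V - S)) = card S * (card {x \<in> V. \<sigma> x = \<sigma> v} - card S)"
proof -
  let ?W = "{x \<in> V. \<sigma> x = \<sigma> v}"
  let ?f = "\<lambda>(x, y). if x < y then (x, y) else (y, x :: nat)"
  have fin: "finite V" using V finite_subset by blast
  have "inj_on ?f (S \<times> (?W - S))" by (auto simp: inj_on_def split: if_splits)
  moreover have "?f ` (S \<times> (?W - S)) = cross (allowed_edges n \<sigma>) S (V - S)"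
  proof (intro equalityI subsetI)
    fix e assume "e \<in> ?f ` (S \<times> (?W - S))"
    then obtain x y where e: "e = ?f (x, y)" "x \<in> S" "y \<in> ?W - S" by auto
    then have "x \<noteq> y" "\<sigma> x = \<sigma> y" "x < n" "y < n" using S V by auto
    then show "e \<in> cross (allowed_edges n \<sigma>) S (V - S)" using e
      by (auto simp: cross_def allowed_edges_def)
  next
    fix e assume e: "e \<in> cross (allowed_edges n \<sigma>) S (V - S)"
    obtain a b where [simp]: "e = (a, b)" by (cases e)
    have ab: "a < b" "\<sigma> a = \<sigma> b" "a \<in> S \<and> b \<in> V - S \<or> b \<in> S \<and> a \<in> V - S"
      using e by (auto simp: cross_def allowed_edges_def)
    then consider "a \<in> S" "b \<in> ?W - S" | "b \<in> S" "a \<in> ?W - S" using S by force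
    then show "e \<in> ?f ` (S \<times> (?W - S))"
    proof cases
      case 1 then show ?thesis using ab by (intro image_eqI[where x = "(a, b)"]) auto
    next
      case 2 then show ?thesis using ab by (intro image_eqI[where x = "(b, a)"]) auto
    qed
  qed
  ultimately have "card (cross (allowed_edges n \<sigma>) S (V - S)) = card (S \<times> (?W - S))"
    using card_image[of ?f "S \<times> (?W - S)"] by (simp only:)
  also have "\<dots> = card S * (card ?W - card S)"
    using S fin finite_subset[OF S] by (simp add: card_cartesian_product card_Diff_subset)
  finally show ?thesis .
qed

lemma sum_comp_prob_class:
  assumes V: "V \<subseteq> {0..<n}" "v \<in> V"
  shows "(\<Sum>S | S \<subseteq> V \<and> v \<in> S. comp_prob p (allowed_edges n \<sigma>) V v S * f S) =
    (\<Sum>S | S \<subseteq> {x \<in> V. \<sigma> x = \<sigma> v} \<and> v \<in> S. conn_prob p (allowed_edges n \<sigma>) v S *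
      (1 - p) ^ (card S * (card {x \<in> V. \<sigma> x = \<sigma> v} - card S)) * f S)"
proof -
  have fin: "finite V" using V finite_subset by blast
  have "(\<Sum>S | S \<subseteq> V \<and> v \<in> S. comp_prob p (allowed_edges n \<sigma>) V v S * f S) =
    (\<Sum>S | S \<subseteq> {x \<in> V. \<sigma> x = \<sigma> v} \<and> v \<in> S. comp_prob p (allowed_edges n \<sigma>) V v S * f S)"
  proof (rule sum.mono_neutral_right)
    show "finite {S. S \<subseteq> V \<and> v \<in> S}" using fin by (auto intro: finite_subset[of _ "Pow V"])
    show "\<forall>S\<in>{S. S \<subseteq> V \<and> v \<in> S} - {S. S \<subseteq> {x \<in> V. \<sigma> x = \<sigma> v} \<and> v \<in> S}.
        comp_prob p (allowed_edges n \<sigma>) V v S * f S = 0"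
    proof
      fix S assume "S \<in> {S. S \<subseteq> V \<and> v \<in> S} - {S. S \<subseteq> {x \<in> V. \<sigma> x = \<sigma> v} \<and> v \<in> S}"
      then have "\<not> (\<forall>x\<in>S. \<sigma> x = \<sigma> v)" by auto
      then show "comp_prob p (allowed_edges n \<sigma>) V v S * f S = 0"
        by (simp add: comp_prob_def conn_prob_outside_class)
    qed
  qed auto
  also have "\<dots> = (\<Sum>S | S \<subseteq> {x \<in> V. \<sigma> x = \<sigma> v} \<and> v \<in> S. conn_prob p (allowed_edges n \<sigma>) v S *
      (1 - p) ^ (card S * (card {x \<in> V. \<sigma> x = \<sigma> v} - card S)) * f S)"
  proof (intro sum.cong refl)
    fix S assume "S \<in> {S. S \<subseteq> {x \<in> V. \<sigma> x = \<sigma> v} \<and> v \<in> S}"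
    then have S: "S \<subseteq> {x \<in> V. \<sigma> x = \<sigma> v}" by blast
    show "comp_prob p (allowed_edges n \<sigma>) V v S * f S = conn_prob p (allowed_edges n \<sigma>) v S *
      (1 - p) ^ (card S * (card {x \<in> V. \<sigma> x = \<sigma> v} - card S)) * f S"
      unfolding comp_prob_def card_cross_class[OF V(1) S] ..
  qed
  finally show ?thesis .
qed

text \<open>Both sides solve the same normalization. The law of the component of v in S has total
  mass 1, and so have the values of \<open>clique_comp\<close>. The terms of proper subsets agree by
  induction on the size, hence so does the one remaining term, that of S itself.\<close>

lemma conn_prob_eq_clique_conn:
  assumes "S \<subseteq> {0..<n}" "v \<in> S" "\<And>x. x \<in> S \<Longrightarrow> \<sigma> x = \<sigma> v"
  shows "conn_prob p (allowed_edges n \<sigma>) v S = clique_conn (1 - p) (card S)"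
  using assms
proof (induction "card S" arbitrary: S rule: less_induct)
  case less
  let ?E = "allowed_edges n \<sigma>"
  have fin: "finite S" using less.prems(1) finite_subset by blast
  have WS: "{x \<in> S. \<sigma> x = \<sigma> v} = S" using less.prems(3) by blast
  define c where "c = card S"
  let ?\<phi> = "\<lambda>t. clique_conn (1 - p) t * (1 - p) ^ (t * (c - t))"
  have c1: "c \<ge> 1" using fin less.prems(2) by (auto simp: c_def Suc_le_eq card_gt_0_iff)
  let ?A = "{T. T \<subseteq> S \<and> v \<in> T}"
  have finA: "finite ?A" using fin by (auto intro: finite_subset[of _ "Pow S"])
  have "1 = (\<Sum>T\<in>?A. conn_prob p ?E v T * (1 - p) ^ (card T * (c - card T)))"
    using sum_comp_prob_class[OF less.prems(1,2), of p \<sigma> "\<lambda>_. 1"] sum_comp_prob[OF fin less.prems(2), of p ?E]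
    unfolding WS c_def by (simp only: mult_1_right)
  also have "\<dots> = conn_prob p ?E v S + (\<Sum>T\<in>?A - {S}. conn_prob p ?E v T * (1 - p) ^ (card T * (c - card T)))"
    using less.prems(2) by (subst sum.remove[OF finA, of S]) (auto simp: c_def)
  also have "(\<Sum>T\<in>?A - {S}. conn_prob p ?E v T * (1 - p) ^ (card T * (c - card T))) = (\<Sum>T\<in>?A - {S}. ?\<phi> (card T))"
  proof (intro sum.cong refl)
    fix T assume T: "T \<in> ?A - {S}"
    then have "card T < card S" using fin by (auto intro: psubset_card_mono)
    then have "conn_prob p ?E v T = clique_conn (1 - p) (card T)"
      by (rule less.hyps) (use T less.prems(1) in \<open>auto intro: less.prems(3)\<close>)
    then show "conn_prob p ?E v T * (1 - p) ^ (card T * (c - card T)) = ?\<phi> (card T)" by simp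
  qed
  also have "\<dots> = (\<Sum>T\<in>?A. ?\<phi> (card T)) - ?\<phi> (card S)"
    using less.prems(2) by (subst sum.remove[OF finA, of S]) auto
  also have "(\<Sum>T\<in>?A. ?\<phi> (card T)) = (\<Sum>t\<in>{1..c}. clique_comp (1 - p) c t)"
    unfolding sum_subsets_by_card[OF fin less.prems(2), of ?\<phi>] by (simp add: clique_comp_def c_def mult.assoc)
  also have "\<dots> = 1" by (rule sum_clique_comp[OF c1])
  finally show ?case by (simp add: c_def)
qed

text \<open>The passage from percolation to numbers: for functions of the component size, the law of
  the component depends only on how many vertices of V share the colour of v.\<close>

lemma sum_comp_prob_card:
  assumes V: "V \<subseteq> {0..<n}" "v \<in> V"
  shows "(\<Sum>S | S \<subseteq> V \<and> v \<in> S. comp_prob p (allowed_edges n \<sigma>) V v S * \<phi> (card S)) =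
    (\<Sum>t\<in>{1..card {x \<in> V. \<sigma> x = \<sigma> v}}. clique_comp (1 - p) (card {x \<in> V. \<sigma> x = \<sigma> v}) t * \<phi> t)"
proof -
  let ?W = "{x \<in> V. \<sigma> x = \<sigma> v}"
  have W: "finite ?W" "v \<in> ?W" using V finite_subset[OF V(1)] by auto
  let ?\<psi> = "\<lambda>t. clique_conn (1 - p) t * (1 - p) ^ (t * (card ?W - t)) * \<phi> t"
  have "(\<Sum>S | S \<subseteq> V \<and> v \<in> S. comp_prob p (allowed_edges n \<sigma>) V v S * \<phi> (card S)) =
      (\<Sum>S | S \<subseteq> ?W \<and> v \<in> S. ?\<psi> (card S))"
    unfolding sum_comp_prob_class[OF V]
  proof (intro sum.cong refl)
    fix S assume "S \<in> {S. S \<subseteq> ?W \<and> v \<in> S}"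
    then have "conn_prob p (allowed_edges n \<sigma>) v S = clique_conn (1 - p) (card S)"
      using V by (intro conn_prob_eq_clique_conn) auto
    then show "conn_prob p (allowed_edges n \<sigma>) v S * (1 - p) ^ (card S * (card ?W - card S)) * \<phi> (card S) =
        ?\<psi> (card S)" by simp
  qed
  also have "\<dots> = (\<Sum>t\<in>{1..card ?W}. clique_comp (1 - p) (card ?W) t * \<phi> t)"
    unfolding sum_subsets_by_card[OF W, of ?\<psi>] by (simp add: clique_comp_def mult_ac)
  finally show ?thesis .
qed

text \<open>The recursion subtracts, so the sign is not visible in it. It follows from reading the
  value as a connection probability for a constant colouring.\<close>

lemma clique_conn_nonneg:
  assumes "0 \<le> r" "r \<le> 1"
  shows "0 \<le> clique_conn r t"
proof (cases "t = 0")
  case True then show ?thesis by (simp add: clique_conn.simps[of r 0])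
next
  case False
  have "conn_prob (1 - r) (allowed_edges t (\<lambda>_. 0)) 0 {0..<t} = clique_conn (1 - (1 - r)) (card {0..<t})"
    using False by (intro conn_prob_eq_clique_conn) auto
  then have "clique_conn r t = conn_prob (1 - r) (allowed_edges t (\<lambda>_. 0)) 0 {0..<t}" by simp
  also have "\<dots> \<ge> 0" using assms by (intro conn_prob_nonneg) auto
  finally show ?thesis .
qed

lemma clique_comp_nonneg: "0 \<le> r \<Longrightarrow> r \<le> 1 \<Longrightarrow> 0 \<le> clique_comp r k t"
  by (simp add: clique_comp_def clique_conn_nonneg)

text \<open>The factor \<open>clique_conn r t\<close> does not involve k and cancels. What remains
  is absorption in the binomial coefficient and one more absent edge for each of the t
  vertices.\<close>

lemma clique_comp_Suc:
  assumes "1 \<le> t" "t \<le> k"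
  shows "clique_comp r (Suc k) t * (real k + 1 - real t) = clique_comp r k t * (real k * r ^ t)"
proof -
  have "(Suc k - t) * (Suc (k - 1) choose (t - 1)) = Suc (k - 1) * ((k - 1) choose (t - 1))"
    using binomial_absorb_comp[of k "t - 1"] assms by (simp add: Suc_diff_le)
  then have "(Suc k - t) * (k choose (t - 1)) = k * ((k - 1) choose (t - 1))"
    using assms by simp
  then have "real ((Suc k - t) * (k choose (t - 1))) = real (k * ((k - 1) choose (t - 1)))" by (simp only:)
  then have b: "real (k choose (t - 1)) * (real k + 1 - real t) = real ((k - 1) choose (t - 1)) * real k"
    using assms by (simp add: of_nat_diff mult_ac add_ac)
  have "t * (Suc k - t) = t * (k - t) + t" using assms by (simp add: Suc_diff_le)
  then have "clique_comp r (Suc k) t = real (k choose (t - 1)) * clique_conn r t * (r ^ (t * (k - t)) * r ^ t)"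
    by (simp add: clique_comp_def power_add)
  then have "clique_comp r (Suc k) t * (real k + 1 - real t) =
     (real (k choose (t - 1)) * (real k + 1 - real t)) * clique_conn r t * (r ^ (t * (k - t)) * r ^ t)" by simp
  also have "\<dots> = clique_comp r k t * (real k * r ^ t)" unfolding b by (simp add: clique_comp_def)
  finally show ?thesis .
qed

section \<open>Second-order exponential estimates and the drift of one exploration step\<close>

lemma exp_chord:
  fixes y :: real
  assumes "0 \<le> s" "s \<le> 1"
  shows "exp (s * y) \<le> s * exp y + (1 - s)"
  using convex_onD[OF exp_convex, of s 0 y] assms by (simp add: algebra_simps)

lemma exp_quadratic_bound:
  fixes y :: real
  shows "exp y \<le> 1 + y + y\<^sup>2 * exp \<bar>y\<bar>"
proof -
  obtain u where u: "\<bar>u\<bar> \<le> \<bar>y\<bar>" "exp y = (\<Sum>m<2. y ^ m / fact m) + exp u / fact 2 * y ^ 2"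
    using Maclaurin_exp_le[of y 2] by blast
  have "exp u \<le> exp \<bar>y\<bar>" using u(1) by simp
  then have "exp u / 2 \<le> exp \<bar>y\<bar>" using exp_ge_zero[of u] by linarith
  then have "exp u / 2 * y\<^sup>2 \<le> exp \<bar>y\<bar> * y\<^sup>2" by (intro mult_right_mono) auto
  then show ?thesis using u(2) by (simp add: numeral_2_eq_2 mult.commute)
qed

lemma square_le_exp:
  fixes x :: real
  assumes "c > 0" "x \<ge> 0"
  shows "x\<^sup>2 \<le> 8 / c\<^sup>2 * exp (c * x / 2)"
proof -
  have "(c * x / 2)\<^sup>2 / 2 \<le> exp (c * x / 2)"
    using exp_lower_Taylor_quadratic[of "c * x / 2"] assms by (smt (verit) divide_nonneg_nonneg mult_nonneg_nonneg)
  then show ?thesis using assms by (simp add: field_simps power2_eq_square)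
qed

text \<open>One step of the exploration multiplies \<open>exp (\<theta> * m)\<close>, \<open>m\<close> the number of vertices of a given
  colour, by at most \<open>exp (\<alpha> t)\<close> on average, where \<open>t\<close> is the number of explored vertices.\<close>

lemma exp_moment_drift:
  fixes P :: "nat \<Rightarrow> real"
  assumes T: "finite T" "\<And>t. t \<in> T \<Longrightarrow> t \<ge> 1"
    and P: "\<And>t. t \<in> T \<Longrightarrow> P t \<ge> 0" "sum P T = 1"
    and M: "(\<Sum>t\<in>T. P t * exp (c * real t)) \<le> M" and c: "c > 0"
    and \<theta>: "0 \<le> \<theta>" "\<theta> \<le> c / 2" and q: "q \<ge> 1" and L: "L = 8 * M / c\<^sup>2"
    and \<alpha>: "\<alpha> = \<theta> / q + L * \<theta>\<^sup>2" "\<alpha> \<le> \<theta>"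
  shows "(\<Sum>t\<in>T. P t * ((1 - 1 / q) * exp (- \<alpha> * real t) + 1 / q * exp ((\<theta> - \<alpha>) * real t))) \<le> 1"
proof -
  have "0 \<le> M" using M P(1) by (smt (verit) sum_nonneg mult_nonneg_nonneg exp_ge_zero)
  then have L0: "L \<ge> 0" using L by simp
  then have \<alpha>0: "\<alpha> \<ge> 0" using \<alpha>(1) \<theta>(1) q by simp
  have pt: "(1 - 1 / q) * exp (- \<alpha> * real t) + 1 / q * exp ((\<theta> - \<alpha>) * real t)
      \<le> 1 - L * \<theta>\<^sup>2 + \<theta>\<^sup>2 * (8 / c\<^sup>2 * exp (c * real t))" if t: "t \<in> T" for t
  proof -
    \<comment> \<open>The exponent c t is spent in two halves: one absorbs
      \<open>exp \<bar>y\<bar>\<close>, as \<theta> is at most c / 2, the other absorbs the square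
      of t.\<close>
    have e: "exp y \<le> 1 + y + \<theta>\<^sup>2 * (8 / c\<^sup>2 * exp (c * real t))" if y: "\<bar>y\<bar> \<le> \<theta> * real t" for y
    proof -
      have "y\<^sup>2 \<le> (\<theta> * real t)\<^sup>2" using y by (metis abs_le_square_iff abs_of_nonneg \<theta>(1) mult_nonneg_nonneg of_nat_0_le_iff)
      moreover have "\<theta> * real t \<le> c * real t / 2" using mult_right_mono[OF \<theta>(2), of "real t"] by simp
      then have "exp \<bar>y\<bar> \<le> exp (c * real t / 2)" using y by simp
      ultimately have "y\<^sup>2 * exp \<bar>y\<bar> \<le> (\<theta> * real t)\<^sup>2 * exp (c * real t / 2)"
        by (intro mult_mono) auto
      also have "\<dots> = \<theta>\<^sup>2 * ((real t)\<^sup>2 * exp (c * real t / 2))" by (simp add: power_mult_distrib)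
      also have "\<dots> \<le> \<theta>\<^sup>2 * ((8 / c\<^sup>2 * exp (c * real t / 2)) * exp (c * real t / 2))"
        using square_le_exp[OF c, of "real t"] by (intro mult_left_mono mult_right_mono) auto
      also have "(8 / c\<^sup>2 * exp (c * real t / 2)) * exp (c * real t / 2) = 8 / c\<^sup>2 * exp (c * real t)"
        by (simp add: exp_add[symmetric])
      finally show ?thesis using exp_quadratic_bound[of y] by linarith
    qed
    define R where "R = \<theta>\<^sup>2 * (8 / c\<^sup>2 * exp (c * real t))"
    have "\<alpha> * real t \<le> \<theta> * real t" "0 \<le> \<alpha> * real t"
      using \<alpha>0 \<alpha>(2) by (auto intro: mult_right_mono)
    then have 1: "exp (- \<alpha> * real t) \<le> 1 + (- \<alpha> * real t) + R"
      and 2: "exp ((\<theta> - \<alpha>) * real t) \<le> 1 + (\<theta> - \<alpha>) * real t + R"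
      unfolding R_def by (intro e; simp add: algebra_simps)+
    have "(1 - 1 / q) * exp (- \<alpha> * real t) + 1 / q * exp ((\<theta> - \<alpha>) * real t)
      \<le> (1 - 1 / q) * (1 + (- \<alpha> * real t) + R) + 1 / q * (1 + (\<theta> - \<alpha>) * real t + R)"
      using q 1 2 by (intro add_mono mult_left_mono) auto
    also have "\<dots> = 1 - (\<alpha> - \<theta> / q) * real t + R" by (simp add: algebra_simps add_divide_distrib diff_divide_distrib)
    also have "\<alpha> - \<theta> / q = L * \<theta>\<^sup>2" using \<alpha>(1) by simp
    finally have "(1 - 1 / q) * exp (- \<alpha> * real t) + 1 / q * exp ((\<theta> - \<alpha>) * real t)
      \<le> 1 - L * \<theta>\<^sup>2 * real t + R" .
    \<comment> \<open>The first-order terms cancel up to \<open>- L * \<theta>\<^sup>2 * t\<close>.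
      Since t is at least 1, this pays for the remainder R, whose mean is at most
      \<open>L * \<theta>\<^sup>2\<close> by the choice of L.\<close>
    moreover have "L * \<theta>\<^sup>2 * 1 \<le> L * \<theta>\<^sup>2 * real t" using L0 T(2)[OF t] by (intro mult_left_mono) auto
    ultimately show ?thesis unfolding R_def by linarith
  qed
  have "(\<Sum>t\<in>T. P t * ((1 - 1 / q) * exp (- \<alpha> * real t) + 1 / q * exp ((\<theta> - \<alpha>) * real t)))
      \<le> (\<Sum>t\<in>T. P t * (1 - L * \<theta>\<^sup>2 + \<theta>\<^sup>2 * (8 / c\<^sup>2 * exp (c * real t))))"
    using pt P(1) by (intro sum_mono mult_left_mono) auto
  also have "\<dots> = (1 - L * \<theta>\<^sup>2) * sum P T + \<theta>\<^sup>2 * (8 / c\<^sup>2) * (\<Sum>t\<in>T. P t * exp (c * real t))"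
  proof -
    have "P t * (1 - L * \<theta>\<^sup>2 + \<theta>\<^sup>2 * (8 / c\<^sup>2 * exp (c * real t))) =
        (1 - L * \<theta>\<^sup>2) * P t + \<theta>\<^sup>2 * (8 / c\<^sup>2) * (P t * exp (c * real t))" for t
      by (simp add: algebra_simps)
    then show ?thesis by (simp only: sum.distrib sum_distrib_left)
  qed
  also have "\<dots> \<le> (1 - L * \<theta>\<^sup>2) * 1 + \<theta>\<^sup>2 * (8 / c\<^sup>2) * M"
    unfolding P(2) using M by (intro add_left_mono mult_left_mono) auto
  also have "\<dots> = 1" by (simp add: L field_simps)
  finally show ?thesis .
qed

section \<open>Exponential decay of component sizes below and above the critical size\<close>

lemma one_minus_power_le_exp:
  fixes x :: real
  assumes "x \<le> 1"
  shows "(1 - x) ^ t \<le> exp (- x * real t)"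
proof -
  have "(1 - x) ^ t \<le> exp (- x) ^ t" using assms exp_ge_add_one_self[of "-x"] by (intro power_mono) auto
  then show ?thesis by (simp add: exp_of_nat_mult[symmetric] mult.commute)
qed

text \<open>Below the critical size, enlarging the vertex set makes a given large component more likely; comparing with
  the larger graph, where the probabilities still add up to 1, yields exponential decay.\<close>

lemma clique_comp_subcritical_step:
  assumes r: "0 < r" "r \<le> 1" "1 \<le> r * exp u" and t: "1 \<le> t" "t \<le> j"
    and b: "real j * (u + b) \<le> 1"
  shows "clique_comp r j t \<le> clique_comp r (Suc j) t * exp (u - (real t - 1) * b)"
proof -
  let ?P = "clique_comp r j t" and ?P' = "clique_comp r (Suc j) t"
  have P': "?P' \<ge> 0" using r by (intro clique_comp_nonneg) auto
  have P: "?P \<ge> 0" using r by (intro clique_comp_nonneg) auto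
  have j: "real j > 0" using t by simp
  have "1 \<le> (r * exp u) ^ t" using r(3) by (rule one_le_power)
  also have "\<dots> = r ^ t * exp (real t * u)" by (simp add: power_mult_distrib exp_of_nat_mult)
  finally have r1: "1 \<le> r ^ t * exp (real t * u)" .
  have e: "1 - (real t - 1) / real j \<le> exp (- (real t - 1) / real j)"
    using exp_ge_add_one_self[of "- (real t - 1) / real j"] unfolding minus_divide_left[symmetric] by linarith
  have ee: "exp (- (real t - 1) / real j) * exp (real t * u) = exp (real t * u - (real t - 1) / real j)"
    unfolding exp_add[symmetric] minus_divide_left[symmetric] by simp
  have "real j * ?P * 1 \<le> real j * ?P * (r ^ t * exp (real t * u))"
    using r1 P by (intro mult_left_mono) auto
  also have "\<dots> = (?P * (real j * r ^ t)) * exp (real t * u)" by simp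
  also have "\<dots> = ?P' * (real j + 1 - real t) * exp (real t * u)"
    by (simp only: clique_comp_Suc[OF t, symmetric])
  also have "real j + 1 - real t = real j * (1 - (real t - 1) / real j)" using j by (simp add: field_simps)
  also have "?P' * (real j * (1 - (real t - 1) / real j)) * exp (real t * u)
      \<le> ?P' * (real j * exp (- (real t - 1) / real j)) * exp (real t * u)"
    using P' j e by (intro mult_right_mono mult_left_mono) auto
  also have "\<dots> = real j * (?P' * exp (real t * u - (real t - 1) / real j))"
    unfolding ee[symmetric] by (simp only: mult_ac)
  finally have "?P \<le> ?P' * exp (real t * u - (real t - 1) / real j)" using j by simp
  also have "\<dots> \<le> ?P' * exp (u - (real t - 1) * b)"
  proof -
    have "u + b \<le> 1 / real j" using b j by (simp add: field_simps)
    then have "(real t - 1) * (u + b) \<le> (real t - 1) * (1 / real j)" using t by (intro mult_left_mono) auto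
    \<comment> \<open>b is the slack in \<open>u + b \<le> 1 / j\<close>, gained once per vertex.
      The isolated u comes from k + 1 - t in the ratio identity, which yields t - 1 instead of
      t.\<close>
    then have "real t * u - (real t - 1) / real j \<le> u - (real t - 1) * b" by (simp add: algebra_simps)
    then show ?thesis using P' by (intro mult_left_mono) auto
  qed
  finally show ?thesis .
qed

text \<open>The condition at the largest size k + d implies it at all smaller ones, because u + b is
  nonnegative; so the one-step bound can be iterated.\<close>

lemma clique_comp_subcritical_iter:
  assumes r: "0 < r" "r \<le> 1" "1 \<le> r * exp u" and t: "1 \<le> t" "t \<le> k"
    and b: "real (k + d) * (u + b) \<le> 1" "0 \<le> u + b"
  shows "clique_comp r k t \<le> clique_comp r (k + d) t * exp (real d * (u - (real t - 1) * b))"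
  using b(1)
proof (induction d)
  case 0 then show ?case by simp
next
  case (Suc d)
  have le: "real (k + d) * (u + b) \<le> 1"
    using Suc.prems mult_right_mono[OF _ b(2), of "real (k + d)" "real (k + Suc d)"] by simp
  have "clique_comp r k t \<le> clique_comp r (k + d) t * exp (real d * (u - (real t - 1) * b))"
    by (rule Suc.IH[OF le])
  also have "\<dots> \<le> (clique_comp r (Suc (k + d)) t * exp (u - (real t - 1) * b)) * exp (real d * (u - (real t - 1) * b))"
    using t le by (intro mult_right_mono clique_comp_subcritical_step r) auto
  also have "\<dots> = clique_comp r (k + Suc d) t * exp (real (Suc d) * (u - (real t - 1) * b))"
    by (simp add: exp_add[symmetric] algebra_simps)
  finally show ?case .
qed

text \<open>The comparison graph has about \<open>\<rho>1 * n / lam\<close> vertices with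
  \<open>\<rho> < \<rho>1 < 1\<close>. It is larger by order n, so the steps accumulate a factor
  \<open>exp (- c * t)\<close> up to a constant, and its probabilities add up to 1.\<close>

lemma clique_comp_subcritical:
  assumes "0 < lam" "0 < \<rho>" "\<rho> < 1"
  shows "\<exists>c>0. \<exists>M. \<exists>N. \<forall>n\<ge>N. \<forall>k\<ge>1. lam * real k \<le> \<rho> * real n \<longrightarrow>
     (\<Sum>t\<in>{1..k}. clique_comp (1 - lam / real n) k t * exp (c * real t)) \<le> M"
proof -
  \<comment> \<open>\<rho>1 is the density of the comparison graph. \<rho>2 splits the budget 1 for
    K (u + b): at most \<rho>2 goes to K u, which slightly exceeds \<rho>1, and at most 1 - \<rho>2
    to K b.\<close>
  define \<rho>1 where "\<rho>1 = (1 + \<rho>) / 2"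
  define \<rho>2 where "\<rho>2 = (1 + \<rho>1) / 2"
  have \<rho>: "\<rho> < \<rho>1" "\<rho>1 < \<rho>2" "\<rho>2 < 1" "0 < \<rho>1" using assms by (auto simp: \<rho>1_def \<rho>2_def)
  define c where "c = (\<rho>1 - \<rho>) * (1 - \<rho>2) / 2"
  have c: "c > 0" using \<rho> by (simp add: c_def)
  define N where "N = Suc (nat \<lceil>max (2 * lam) (max (\<rho>2 * lam / (\<rho>2 - \<rho>1)) (2 * lam / (\<rho>1 - \<rho>)))\<rceil>)"
  have "(\<Sum>t\<in>{1..k}. clique_comp (1 - lam / real n) k t * exp (c * real t)) \<le> exp (2 + c)"
    if n: "n \<ge> N" and k: "k \<ge> 1" "lam * real k \<le> \<rho> * real n" for n k
  proof -
    have "real n \<ge> max (2 * lam) (max (\<rho>2 * lam / (\<rho>2 - \<rho>1)) (2 * lam / (\<rho>1 - \<rho>)))"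
      using n unfolding N_def by linarith
    then have n1: "real n \<ge> 2 * lam" and n2: "real n \<ge> \<rho>2 * lam / (\<rho>2 - \<rho>1)" and n3: "real n \<ge> 2 * lam / (\<rho>1 - \<rho>)"
      by auto
    have n0: "real n > 0" using n1 assms by linarith
    define r where "r = 1 - lam / real n"
    have r: "0 < r" "r \<le> 1" using n1 n0 assms by (auto simp: r_def field_simps)
    \<comment> \<open>Chosen so that 1 / r is exactly 1 + u, hence at most exp u.\<close>
    define u where "u = lam / (real n - lam)"
    have nl: "real n - lam > 0" using n1 assms by linarith
    have u0: "u \<ge> 0" using nl assms by (simp add: u_def)
    have "1 = r * (1 + u)" using nl n0 by (simp add: r_def u_def field_simps)
    also have "\<dots> \<le> r * exp u" using r exp_ge_add_one_self[of u] by (intro mult_left_mono) auto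
    finally have ru: "1 \<le> r * exp u" .
    define b where "b = (1 - \<rho>2) * lam / real n"
    have b0: "b \<ge> 0" using \<rho> assms by (simp add: b_def)
    define K where "K = nat \<lfloor>\<rho>1 * real n / lam\<rfloor>"
    have Kle: "real K \<le> \<rho>1 * real n / lam" using \<rho> assms by (simp add: K_def)
    have Kge: "real K > \<rho>1 * real n / lam - 1" unfolding K_def by linarith
    have kle: "real k \<le> \<rho> * real n / lam" using k(2) assms by (simp add: field_simps)
    have dd: "real K - real k \<ge> (\<rho>1 - \<rho>) * real n / (2 * lam)"
    proof -
      have "1 \<le> (\<rho>1 - \<rho>) * real n / (2 * lam)" using n3 \<rho> assms by (simp add: field_simps)
      moreover have "(\<rho>1 - \<rho>) * real n / (2 * lam) + (\<rho>1 - \<rho>) * real n / (2 * lam) = \<rho>1 * real n / lam - \<rho> * real n / lam"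
        using assms by (simp add: field_simps)
      ultimately show ?thesis using Kge kle by linarith
    qed
    then have kK: "k \<le> K" using \<rho> assms n0 by (smt (verit) divide_nonneg_pos mult_nonneg_nonneg of_nat_le_iff)
    define d where "d = K - k"
    have Kd: "K = k + d" using kK by (simp add: d_def)
    have Ku: "real K * u \<le> \<rho>2"
    proof -
      have "real K * u \<le> \<rho>1 * real n / lam * u" using Kle u0 by (rule mult_right_mono)
      also have "\<dots> = \<rho>1 * real n / (real n - lam)" using assms by (simp add: u_def)
      also have "\<dots> \<le> \<rho>2" using n2 nl \<rho> by (simp add: field_simps)
      finally show ?thesis .
    qed
    have Kb: "real K * b \<le> 1 - \<rho>2"
    proof -
      have "real K * b \<le> \<rho>1 * real n / lam * b" using Kle b0 by (rule mult_right_mono)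
      also have "\<dots> = \<rho>1 * (1 - \<rho>2)" using assms n0 by (simp add: b_def)
      also have "\<dots> \<le> 1 - \<rho>2" using \<rho> by (simp add: mult_le_cancel_right1)
      finally show ?thesis .
    qed
    have Kub: "real (k + d) * (u + b) \<le> 1" using Ku Kb Kd by (simp add: distrib_left)
    have du: "real d * u \<le> 1"
    proof -
      have "real d * u \<le> real K * u" using u0 Kd by (intro mult_right_mono) auto
      then show ?thesis using Ku \<rho> by linarith
    qed
    have db: "c \<le> real d * b"
    proof -
      have "c = (\<rho>1 - \<rho>) * real n / (2 * lam) * b" using n0 assms by (simp add: b_def c_def)
      also have "\<dots> \<le> real d * b" using dd b0 Kd by (intro mult_right_mono) auto
      finally show ?thesis .
    qed
    have pt: "clique_comp r k t * exp (c * real t) \<le> exp (2 + c) * clique_comp r K t" if t: "t \<in> {1..k}" for t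
    proof -
      have P: "clique_comp r K t \<ge> 0" using r by (intro clique_comp_nonneg) auto
      have "clique_comp r k t \<le> clique_comp r K t * exp (real d * (u - (real t - 1) * b))"
        unfolding Kd using t u0 b0 Kub by (intro clique_comp_subcritical_iter r ru) auto
      also have "\<dots> \<le> clique_comp r K t * exp (2 - (real t - 1) * c)"
      proof -
        have "(real t - 1) * c \<le> (real t - 1) * (real d * b)" using t db by (intro mult_left_mono) auto
        then have "real d * (u - (real t - 1) * b) \<le> 2 - (real t - 1) * c" using du by (simp add: algebra_simps)
        then show ?thesis using P by (intro mult_left_mono) auto
      qed
      finally have "clique_comp r k t * exp (c * real t)
          \<le> clique_comp r K t * exp (2 - (real t - 1) * c) * exp (c * real t)" by (rule mult_right_mono) simp
      also have "\<dots> = exp (2 + c) * clique_comp r K t"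
        by (simp add: exp_add[symmetric] algebra_simps)
      finally show ?thesis .
    qed
    have "(\<Sum>t\<in>{1..k}. clique_comp r k t * exp (c * real t)) \<le> (\<Sum>t\<in>{1..k}. exp (2 + c) * clique_comp r K t)"
      by (rule sum_mono[OF pt])
    also have "\<dots> \<le> (\<Sum>t\<in>{1..K}. exp (2 + c) * clique_comp r K t)"
      using kK r by (intro sum_mono2) (auto intro!: mult_nonneg_nonneg clique_comp_nonneg)
    also have "\<dots> = exp (2 + c)" using sum_clique_comp[of K r] k kK by (simp add: sum_distrib_left[symmetric])
    finally show ?thesis by (simp add: r_def)
  qed
  then show ?thesis using c by blast
qed

text \<open>Here x and w stand for \<open>lam * j / n\<close> and \<open>lam * t / n\<close>. The
  hypothesis on v says that v lies strictly below \<open>(v + \<rho>) * (1 - exp (- v))\<close>,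
  that is, below the giant at density v + \<rho>. Convexity spreads this strict inequality to all w
  that leave density at least \<rho>, with a uniform factor 1 + \<eta>.\<close>

lemma supercritical_growth:
  fixes v \<rho> lam :: real
  assumes v: "v > 0" and \<rho>: "v < \<rho> * (exp v - 1)" and \<rho>0: "\<rho> > 0"
  shows "\<exists>\<eta>>0. \<forall>x w. v + \<rho> \<le> x \<longrightarrow> x \<le> lam \<longrightarrow> 0 \<le> w \<longrightarrow> w \<le> x - \<rho> \<longrightarrow> (1 + \<eta>) * w \<le> x * (1 - exp (- w))"
proof -
  define e where "e = \<rho> * (exp v - 1) / v - 1"
  have e: "e > 0" using v \<rho> by (simp add: e_def)
  have "(1 + exp (- lam) * e) * w \<le> x * (1 - exp (- w))"
    if x: "v + \<rho> \<le> x" "x \<le> lam" and w: "0 \<le> w" "w \<le> x - \<rho>" for x w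
  proof (cases "w \<le> v")
    case True
    \<comment> \<open>For w up to v the bound v + \<rho> on x suffices: 1 - exp (- w) lies above its
      chord from 0 to v.\<close>
    have "exp (w / v * (- v)) \<le> w / v * exp (- v) + (1 - w / v)" using w True v by (intro exp_chord) auto
    then have 1: "w / v * (1 - exp (- v)) \<le> 1 - exp (- w)" using v by (simp add: algebra_simps)
    have "exp (- lam) * e \<le> exp (- v) * e" using x \<rho>0 e by (intro mult_right_mono) auto
    then have "(1 + exp (- lam) * e) * w \<le> (1 + exp (- v) * e) * w" using w by (intro mult_right_mono) auto
    also have "\<dots> = (v + \<rho>) * (w / v * (1 - exp (- v)))"
      using v by (simp add: e_def field_simps exp_minus)
    also have "\<dots> \<le> (v + \<rho>) * (1 - exp (- w))" using 1 v \<rho>0 by (intro mult_left_mono) auto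
    also have "\<dots> \<le> x * (1 - exp (- w))" using x w by (intro mult_right_mono) auto
    finally show ?thesis .
  next
    case False
    then have wv: "v < w" by simp
    \<comment> \<open>For w beyond v the bound w + \<rho> on x takes over, together with the growth
      of (exp w - 1) / w.\<close>
    have "exp (v / w * w) \<le> v / w * exp w + (1 - v / w)" using wv v by (intro exp_chord) auto
    then have "exp v - 1 \<le> v / w * (exp w - 1)" using wv v by (simp add: algebra_simps)
    then have "w / v * (exp v - 1) \<le> exp w - 1" using wv v by (simp add: field_simps)
    then have "\<rho> * (w / v * (exp v - 1)) \<le> \<rho> * (exp w - 1)" using \<rho>0 by (intro mult_left_mono) auto
    then have 1: "w * (e + 1) \<le> \<rho> * (exp w - 1)" using v by (simp add: e_def field_simps)
    have "exp (- lam) * e \<le> exp (- w) * e" using x w \<rho>0 e by (intro mult_right_mono) auto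
    then have "(1 + exp (- lam) * e) * w \<le> (1 + exp (- w) * e) * w" using w by (intro mult_right_mono) auto
    also have "\<dots> = w + exp (- w) * (w * (e + 1)) - exp (- w) * w" by (simp add: algebra_simps)
    also have "\<dots> \<le> w + exp (- w) * (\<rho> * (exp w - 1)) - exp (- w) * w"
      using 1 by (intro diff_mono add_left_mono mult_left_mono) auto
    also have "\<dots> = (w + \<rho>) * (1 - exp (- w))" by (simp add: algebra_simps exp_minus)
    also have "\<dots> \<le> x * (1 - exp (- w))" using w by (intro mult_right_mono) auto
    finally show ?thesis .
  qed
  then show ?thesis using e by (intro exI[of _ "exp (- lam) * e"]) auto
qed

text \<open>The ratio identity read in the other direction: the deficit \<eta> t makes the ratio at
  most 1 - \<eta> t / (j - t), and j - t may be replaced by the larger x.\<close>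

lemma clique_comp_supercritical_step:
  assumes r: "0 < r" "r \<le> 1" and t: "1 \<le> t" "t < j"
    and j: "real j * r ^ t \<le> real j - real t - \<eta> * real t" "real j \<le> x" and \<eta>: "\<eta> \<ge> 0"
  shows "clique_comp r (Suc j) t \<le> clique_comp r j t * exp (- \<eta> * real t / x)"
proof -
  let ?P = "clique_comp r j t" and ?P' = "clique_comp r (Suc j) t"
  have P: "?P \<ge> 0" using r by (intro clique_comp_nonneg) auto
  have x: "x > 0" using t j by linarith
  have "?P' * (real j + 1 - real t) = ?P * (real j * r ^ t)" using t by (intro clique_comp_Suc) auto
  also have "\<dots> \<le> ?P * (real j - real t - \<eta> * real t)" using j P by (intro mult_left_mono) auto
  also have "\<dots> \<le> ?P * ((real j - real t) * (1 + - \<eta> * real t / x))"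
  proof -
    have "(real j - real t) / x \<le> 1" using t j x by (simp add: field_simps)
    then have "(real j - real t) / x * (\<eta> * real t) \<le> 1 * (\<eta> * real t)" using \<eta> by (intro mult_right_mono) auto
    then show ?thesis using P by (intro mult_left_mono) (simp_all add: algebra_simps)
  qed
  also have "\<dots> \<le> ?P * ((real j - real t) * exp (- \<eta> * real t / x))"
    using P t exp_ge_add_one_self[of "- \<eta> * real t / x"] by (intro mult_left_mono) auto
  also have "\<dots> \<le> ?P * ((real j + 1 - real t) * exp (- \<eta> * real t / x))"
    using P by (intro mult_left_mono mult_right_mono) auto
  finally have "?P' * (real j + 1 - real t) \<le> ?P * exp (- \<eta> * real t / x) * (real j + 1 - real t)"
    by (simp add: mult_ac)
  then show ?thesis using t by (simp add: mult_le_cancel_right)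
qed

lemma clique_comp_supercritical_iter:
  assumes r: "0 < r" "r \<le> 1" and t: "1 \<le> t" "t < k"
    and j: "\<And>j. k \<le> j \<Longrightarrow> j < k + d \<Longrightarrow> real j * r ^ t \<le> real j - real t - \<eta> * real t \<and> real j \<le> x"
    and \<eta>: "\<eta> \<ge> 0"
  shows "clique_comp r (k + d) t \<le> clique_comp r k t * exp (- \<eta> * real t / x * real d)"
  using j
proof (induction d)
  case 0 then show ?case by simp
next
  case (Suc d)
  have "clique_comp r (k + Suc d) t \<le> clique_comp r (k + d) t * exp (- \<eta> * real t / x)"
    using Suc.prems[of "k + d"] t \<eta> r clique_comp_supercritical_step[of r t "k + d" \<eta> x] by simp
  also have "\<dots> \<le> clique_comp r k t * exp (- \<eta> * real t / x * real d) * exp (- \<eta> * real t / x)"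
    using Suc by (intro mult_right_mono) auto
  also have "\<dots> = clique_comp r k t * exp (- \<eta> * real t / x * real (Suc d))"
    by (simp add: exp_add[symmetric] algebra_simps add_divide_distrib)
  finally show ?case .
qed

text \<open>Above the critical size the comparison goes the other way, with a smaller graph. It covers all
  components whose removal leaves a supercritical graph.\<close>

lemma clique_comp_supercritical:
  assumes lam: "lam > 0" and v: "v > 0" and \<rho>: "v < (\<rho> - \<delta>) * (exp v - 1)" and \<delta>: "\<delta> > 0"
  shows "\<exists>\<kappa>>0. \<exists>N. \<forall>n\<ge>N. \<forall>k\<le>n. (v + \<rho>) * real n \<le> lam * real k \<longrightarrow>
    (\<Sum>t | t \<in> {1..k} \<and> \<rho> * real n < lam * (real k - real t).
       clique_comp (1 - lam / real n) k t * exp (\<kappa> * real t)) \<le> exp (- \<kappa>)"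
proof -
  have \<rho>\<delta>: "\<rho> - \<delta> > 0"
  proof (rule ccontr)
    assume "\<not> \<rho> - \<delta> > 0"
    then have "(\<rho> - \<delta>) * (exp v - 1) \<le> 0" using v by (intro mult_nonpos_nonneg) auto
    then show False using \<rho> v by linarith
  qed
  \<comment> \<open>The comparison graph lacks about \<open>\<delta> * n / lam\<close> vertices,
    which lowers both its density and the density left after removal of the component by at most
    \<delta>. Hence \<rho> - \<delta> in place of \<rho>.\<close>
  obtain \<eta> where \<eta>: "\<eta> > 0" "\<And>x w. v + (\<rho> - \<delta>) \<le> x \<Longrightarrow> x \<le> lam \<Longrightarrow> 0 \<le> w \<Longrightarrow> w \<le> x - (\<rho> - \<delta>) \<Longrightarrow>
      (1 + \<eta>) * w \<le> x * (1 - exp (- w))"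
    using supercritical_growth[OF v \<rho> \<rho>\<delta>, of lam] by blast
  \<comment> \<open>d / n is at least \<open>\<delta> / (2 * lam)\<close>, so the comparison gains
    \<open>exp (- 2 * \<kappa> * t)\<close>. One half of the exponent pays for the moment, the other
    gives \<open>exp (- \<kappa>)\<close> because t is at least 1.\<close>
  define \<kappa> where "\<kappa> = \<eta> * \<delta> / (4 * lam)"
  have \<kappa>: "\<kappa> > 0" using \<eta> \<delta> lam by (simp add: \<kappa>_def)
  define N where "N = Suc (nat \<lceil>max (2 * lam) (2 * lam / \<delta>)\<rceil>)"
  have "(\<Sum>t | t \<in> {1..k} \<and> \<rho> * real n < lam * (real k - real t).
       clique_comp (1 - lam / real n) k t * exp (\<kappa> * real t)) \<le> exp (- \<kappa>)"
    if n: "n \<ge> N" and k: "k \<le> n" "(v + \<rho>) * real n \<le> lam * real k" for n k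
  proof -
    have "real n \<ge> max (2 * lam) (2 * lam / \<delta>)" using n unfolding N_def by linarith
    then have n1: "real n \<ge> 2 * lam" and n2: "real n \<ge> 2 * lam / \<delta>" by auto
    have n0: "real n > 0" using n1 lam by linarith
    define r where "r = 1 - lam / real n"
    have r: "0 < r" "r \<le> 1" using n1 n0 lam by (auto simp: r_def field_simps)
    define d where "d = nat \<lfloor>\<delta> * real n / lam\<rfloor>"
    have dle: "real d \<le> \<delta> * real n / lam" using \<delta> lam by (simp add: d_def)
    have dge: "real d > \<delta> * real n / lam - 1" unfolding d_def by linarith
    have dn: "real d / real n \<ge> \<delta> / (2 * lam)"
    proof -
      have "1 \<le> \<delta> * real n / (2 * lam)" using n2 \<delta> lam by (simp add: field_simps)
      moreover have "\<delta> * real n / (2 * lam) + \<delta> * real n / (2 * lam) = \<delta> * real n / lam"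
        using lam by (simp add: field_simps)
      ultimately have "real d \<ge> \<delta> * real n / (2 * lam)" using dge by linarith
      then show ?thesis using n0 lam by (simp add: field_simps)
    qed
    have lamd: "lam * real d \<le> \<delta> * real n" using dle lam by (simp add: field_simps)
    have "lam * real d < lam * real k"
    proof -
      have "\<delta> * real n < (v + \<rho>) * real n" using n0 v \<rho>\<delta> by (intro mult_strict_right_mono) auto
      then show ?thesis using k lamd by linarith
    qed
    then have dk: "d < k" using lam by simp
    define k' where "k' = k - d"
    have kk: "k = k' + d" using dk by (simp add: k'_def)
    let ?T = "{t. t \<in> {1..k} \<and> \<rho> * real n < lam * (real k - real t)}"
    have pt: "t \<in> {1..k'}" "clique_comp r k t * exp (\<kappa> * real t) \<le> clique_comp r k' t * exp (- \<kappa>)"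
      if t: "t \<in> ?T" for t
    proof -
      have P: "clique_comp r k' t \<ge> 0" using r by (intro clique_comp_nonneg) auto
      have tj: "\<rho> * real n - \<delta> * real n < lam * (real j - real t)" if "k' \<le> j" for j
      proof -
        have "lam * real k' \<le> lam * real j" using that lam by (intro mult_left_mono) auto
        moreover have "lam * real k = lam * real k' + lam * real d" by (simp add: kk distrib_left)
        moreover have "\<rho> * real n < lam * real k - lam * real t" using t by (simp add: right_diff_distrib)
        ultimately show ?thesis using lamd by (simp add: right_diff_distrib)
      qed
      have "0 < (\<rho> - \<delta>) * real n" using \<rho>\<delta> n0 by simp
      then have "0 < lam * (real k' - real t)" using tj[of k'] by (simp add: left_diff_distrib)
      then have tk: "t < k'" using lam by (simp add: zero_less_mult_iff)
      then show "t \<in> {1..k'}" using t by auto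
      have "clique_comp r (k' + d) t \<le> clique_comp r k' t * exp (- \<eta> * real t / real n * real d)"
      proof (rule clique_comp_supercritical_iter[OF r _ tk])
        fix j assume j: "k' \<le> j" "j < k' + d"
        define x where "x = lam * real j / real n"
        define w where "w = lam * real t / real n"
        have "lam * real j \<le> lam * real n" using j kk k lam by (intro mult_left_mono) auto
        then have x1: "x \<le> lam" using n0 by (simp add: x_def field_simps)
        have "lam * real k' \<le> lam * real j" using j lam by (intro mult_left_mono) auto
        then have "(v + \<rho>) * real n - \<delta> * real n \<le> lam * real j"
          using k lamd by (simp add: kk distrib_left)
        then have x2: "v + (\<rho> - \<delta>) \<le> x" using n0 by (simp add: x_def field_simps)
        have w2: "w \<le> x - (\<rho> - \<delta>)" using tj[OF j(1)] n0 by (simp add: x_def w_def field_simps)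
        have w0: "0 \<le> w" using lam by (simp add: w_def)
        have "(1 + \<eta>) * w \<le> x * (1 - exp (- w))" by (rule \<eta>(2)[OF x2 x1 w0 w2])
        also have "\<dots> \<le> x * (1 - r ^ t)"
        proof -
          have "r ^ t \<le> exp (- w)" using one_minus_power_le_exp[of "lam / real n" t] r
            by (simp add: r_def w_def)
          then show ?thesis using lam by (intro mult_left_mono) (auto simp: x_def)
        qed
        finally have "(1 + \<eta>) * w * real n \<le> x * (1 - r ^ t) * real n"
          by (rule mult_right_mono) simp
        moreover have "w * real n = lam * real t" "x * real n = lam * real j"
          using n0 by (auto simp: x_def w_def)
        ultimately have "(1 + \<eta>) * (lam * real t) \<le> (lam * real j) * (1 - r ^ t)"
          by (metis (no_types, lifting) mult.assoc mult.commute)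
        then have "lam * ((1 + \<eta>) * real t) \<le> lam * (real j * (1 - r ^ t))" by (simp add: mult_ac)
        then have "(1 + \<eta>) * real t \<le> real j * (1 - r ^ t)" using lam by simp
        then show "real j * r ^ t \<le> real j - real t - \<eta> * real t \<and> real j \<le> real n"
          using j kk k by (simp add: algebra_simps)
      qed (use t \<eta> in auto)
      also have "\<dots> \<le> clique_comp r k' t * exp (- 2 * \<kappa> * real t)"
      proof -
        have "2 * \<kappa> * real t = \<eta> * real t * (\<delta> / (2 * lam))" by (simp add: \<kappa>_def)
        also have "\<dots> \<le> \<eta> * real t * (real d / real n)" using dn \<eta> by (intro mult_left_mono) auto
        finally have "- \<eta> * real t / real n * real d \<le> - 2 * \<kappa> * real t" by simp
        then show ?thesis using P by (intro mult_left_mono) auto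
      qed
      finally have "clique_comp r k t * exp (\<kappa> * real t) \<le> clique_comp r k' t * exp (- 2 * \<kappa> * real t) * exp (\<kappa> * real t)"
        unfolding kk by (rule mult_right_mono) simp
      also have "\<dots> = clique_comp r k' t * exp (- \<kappa> * real t)" by (simp add: exp_add[symmetric] mult.assoc)
      also have "\<dots> \<le> clique_comp r k' t * exp (- \<kappa>)"
      proof -
        have "\<kappa> * 1 \<le> \<kappa> * real t" using t \<kappa> by (intro mult_left_mono) auto
        then show ?thesis using P by (intro mult_left_mono) auto
      qed
      finally show "clique_comp r k t * exp (\<kappa> * real t) \<le> clique_comp r k' t * exp (- \<kappa>)" .
    qed
    have "(\<Sum>t\<in>?T. clique_comp r k t * exp (\<kappa> * real t)) \<le> (\<Sum>t\<in>?T. clique_comp r k' t * exp (- \<kappa>))"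
      by (rule sum_mono[OF pt(2)])
    also have "\<dots> \<le> (\<Sum>t\<in>{1..k'}. clique_comp r k' t * exp (- \<kappa>))"
      using pt(1) r by (intro sum_mono2) (auto intro!: mult_nonneg_nonneg clique_comp_nonneg)
    also have "\<dots> = exp (- \<kappa>)" using sum_clique_comp[of k' r] dk by (simp add: sum_distrib_right[symmetric] k'_def)
    finally show ?thesis by (simp add: r_def)
  qed
  then show ?thesis using \<kappa> by blast
qed

section \<open>Colouring the components\<close>

lemma rc_kernel_cong:
  assumes "\<And>x. x \<in> V \<Longrightarrow> \<tau> x = \<tau>' x"
  shows "rc_kernel p s E V \<tau> = rc_kernel p s E V \<tau>'"
  unfolding rc_kernel_def
proof (intro sum.cong refl)
  fix w assume "w \<in> Pow (E \<inter> V \<times> V)"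
  then have "(\<forall>(x, y)\<in>w. \<tau> x = \<tau> y) \<longleftrightarrow> (\<forall>(x, y)\<in>w. \<tau>' x = \<tau>' y)"
    by (intro ball_cong) (auto simp: assms subset_iff)
  then show "perc_wt p (E \<inter> V \<times> V) w * (if \<forall>(x, y)\<in>w. \<tau> x = \<tau> y then s ^ comp_count V w else 0) =
    perc_wt p (E \<inter> V \<times> V) w * (if \<forall>(x, y)\<in>w. \<tau>' x = \<tau>' y then s ^ comp_count V w else 0)" by simp
qed

text \<open>The expectation of a function of the numbers of vertices of each colour, when the components of
  the percolation on \<open>V\<close> are coloured independently and uniformly.\<close>

definition col_exp :: "real \<Rightarrow> nat \<Rightarrow> ('a \<times> 'a) set \<Rightarrow> 'a set \<Rightarrow> ((nat \<Rightarrow> nat) \<Rightarrow> real) \<Rightarrow> real" where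
  "col_exp p q E V h = (\<Sum>\<tau>\<in>PiE V (\<lambda>_. {0..<q}). rc_kernel p (1 / real q) E V \<tau> * h (\<lambda>j. card {x \<in> V. \<tau> x = j}))"

lemma col_exp_empty: "col_exp p q E {} h = h (\<lambda>_. 0)"
  by (simp add: col_exp_def rc_kernel_empty)

lemma col_exp_mono:
  assumes "0 \<le> p" "p \<le> 1" "\<And>m. h m \<le> h' m"
  shows "col_exp p q E V h \<le> col_exp p q E V h'"
  unfolding col_exp_def using assms by (intro sum_mono mult_left_mono rc_kernel_nonneg) auto

lemma col_exp_cmult: "col_exp p q E V (\<lambda>m. a * h m) = a * col_exp p q E V h"
  by (simp add: col_exp_def sum_distrib_left mult_ac)

lemma col_exp_sum: "col_exp p q E V (\<lambda>m. \<Sum>j\<in>J. h j m) = (\<Sum>j\<in>J. col_exp p q E V (h j))"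
  unfolding col_exp_def by (simp only: sum_distrib_left) (rule sum.swap)

text \<open>A colouring that is constant on S amounts to a colour c for S and a colouring of V - S,
  and the counts are those of V - S with \<open>card S\<close> added at c.\<close>

lemma col_exp_rec:
  assumes V: "finite V" "v \<in> V"
  shows "col_exp p q E V h = (\<Sum>S | S \<subseteq> V \<and> v \<in> S. comp_prob p E V v S *
    (1 / real q * (\<Sum>c\<in>{0..<q}. col_exp p q E (V - S) (\<lambda>m. h (\<lambda>j. (if j = c then card S else 0) + m j)))))"
proof -
  let ?C = "{0..<q}"
  let ?K = "\<lambda>V. rc_kernel p (1 / real q) E V"
  let ?n = "\<lambda>V \<tau> j. card {x \<in> V. \<tau> x = j}"
  have "col_exp p q E V h = (\<Sum>\<tau>\<in>PiE V (\<lambda>_. ?C). \<Sum>S | S \<subseteq> V \<and> v \<in> S. comp_prob p E V v S *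
     (1 / real q * (if \<forall>x\<in>S. \<tau> x = \<tau> v then ?K (V - S) \<tau> else 0)) * h (?n V \<tau>))"
    unfolding col_exp_def rc_kernel_rec[OF V, of p "1 / real q" E] sum_distrib_right ..
  also have "\<dots> = (\<Sum>S | S \<subseteq> V \<and> v \<in> S. \<Sum>\<tau>\<in>PiE V (\<lambda>_. ?C). comp_prob p E V v S *
     (1 / real q * (if \<forall>x\<in>S. \<tau> x = \<tau> v then ?K (V - S) \<tau> else 0)) * h (?n V \<tau>))"
    by (rule sum.swap)
  also have "\<dots> = (\<Sum>S | S \<subseteq> V \<and> v \<in> S. comp_prob p E V v S *
    (1 / real q * (\<Sum>c\<in>?C. col_exp p q E (V - S) (\<lambda>m. h (\<lambda>j. (if j = c then card S else 0) + m j)))))"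
  proof (intro sum.cong refl)
    fix S assume "S \<in> {S. S \<subseteq> V \<and> v \<in> S}"
    then have S: "S \<subseteq> V" "v \<in> S" by auto
    have finPi: "finite (PiE V (\<lambda>_. ?C))" using V by (simp add: finite_PiE)
    let ?T = "{\<tau> \<in> PiE V (\<lambda>_. ?C). \<forall>x\<in>S. \<tau> x = \<tau> v}"
    have "(\<Sum>\<tau>\<in>PiE V (\<lambda>_. ?C). comp_prob p E V v S *
       (1 / real q * (if \<forall>x\<in>S. \<tau> x = \<tau> v then ?K (V - S) \<tau> else 0)) * h (?n V \<tau>)) =
      comp_prob p E V v S * (1 / real q * (\<Sum>\<tau>\<in>PiE V (\<lambda>_. ?C). if \<forall>x\<in>S. \<tau> x = \<tau> v then ?K (V - S) \<tau> * h (?n V \<tau>) else 0))"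
      unfolding sum_distrib_left by (intro sum.cong refl) simp
    also have "(\<Sum>\<tau>\<in>PiE V (\<lambda>_. ?C). if \<forall>x\<in>S. \<tau> x = \<tau> v then ?K (V - S) \<tau> * h (?n V \<tau>) else 0) =
      (\<Sum>\<tau>\<in>?T. ?K (V - S) \<tau> * h (?n V \<tau>))"
      using finPi by (rule sum.inter_filter[symmetric])
    also have "\<dots> = (\<Sum>(c, \<tau>)\<in>?C \<times> PiE (V - S) (\<lambda>_. ?C). ?K (V - S) \<tau> * h (\<lambda>j. (if j = c then card S else 0) + ?n (V - S) \<tau> j))"
    proof (rule sum.reindex_bij_witness[where j = "\<lambda>\<tau>. (\<tau> v, restrict \<tau> (V - S))"
          and i = "\<lambda>(c, \<tau>) x. if x \<in> S then c else \<tau> x"])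
      fix \<tau> assume "\<tau> \<in> ?T"
      then have \<tau>: "\<tau> \<in> PiE V (\<lambda>_. ?C)" "\<And>x. x \<in> S \<Longrightarrow> \<tau> x = \<tau> v" by auto
      have "(if x \<in> S then \<tau> v else restrict \<tau> (V - S) x) = \<tau> x" for x
      proof (cases "x \<in> S")
        case True then show ?thesis using \<tau>(2)[OF True] by simp
      next
        case False then show ?thesis using PiE_arb[OF \<tau>(1), of x] by (simp add: restrict_def)
      qed
      then show "(case (\<tau> v, restrict \<tau> (V - S)) of (c, \<tau>) \<Rightarrow> \<lambda>x. if x \<in> S then c else \<tau> x) = \<tau>" by simp
      have "\<tau> x \<in> ?C" if "x \<in> V" for x using PiE_mem[OF \<tau>(1) that] .
      then show "(\<tau> v, restrict \<tau> (V - S)) \<in> ?C \<times> PiE (V - S) (\<lambda>_. ?C)"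
        using V(2) by (simp only: mem_Sigma_iff) (simp add: restrict_PiE_iff)
      have K: "?K (V - S) (restrict \<tau> (V - S)) = ?K (V - S) \<tau>" by (rule rc_kernel_cong) simp
      have n: "?n V \<tau> j = (if j = \<tau> v then card S else 0) + ?n (V - S) (restrict \<tau> (V - S)) j" for j
      proof -
        have "{x \<in> V. \<tau> x = j} = (if j = \<tau> v then S else {}) \<union> {x \<in> V - S. restrict \<tau> (V - S) x = j}"
        proof (intro set_eqI)
          fix x
          show "x \<in> {x \<in> V. \<tau> x = j} \<longleftrightarrow> x \<in> (if j = \<tau> v then S else {}) \<union> {x \<in> V - S. restrict \<tau> (V - S) x = j}"
            using \<tau>(2)[of x] S by (cases "x \<in> S") auto
        qed
        also have "card \<dots> = card (if j = \<tau> v then S else {}) + card {x \<in> V - S. restrict \<tau> (V - S) x = j}"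
          using V S finite_subset[OF S(1) V(1)] by (intro card_Un_disjoint) auto
        finally show ?thesis by (simp split: if_splits)
      qed
      show "(case (\<tau> v, restrict \<tau> (V - S)) of (c, \<tau>) \<Rightarrow> ?K (V - S) \<tau> * h (\<lambda>j. (if j = c then card S else 0) + ?n (V - S) \<tau> j))
        = ?K (V - S) \<tau> * h (?n V \<tau>)"
        unfolding case_prod_conv K n ..
    next
      fix ct assume "ct \<in> ?C \<times> PiE (V - S) (\<lambda>_. ?C)"
      then obtain c \<tau> where [simp]: "ct = (c, \<tau>)" and c: "c \<in> ?C" and \<tau>: "\<tau> \<in> PiE (V - S) (\<lambda>_. ?C)" by auto
      let ?\<tau> = "\<lambda>x. if x \<in> S then c else \<tau> x"
      have 1: "?\<tau> \<in> PiE V (\<lambda>_. ?C)"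
      proof (rule PiE_I)
        fix x assume "x \<in> V" then show "?\<tau> x \<in> ?C" using c PiE_mem[OF \<tau>, of x] by auto
      next
        fix x assume "x \<notin> V" then show "?\<tau> x = undefined" using S PiE_arb[OF \<tau>, of x] by auto
      qed
      then show "(case ct of (c, \<tau>) \<Rightarrow> \<lambda>x. if x \<in> S then c else \<tau> x) \<in> ?T" using S(2) by simp
      have "restrict ?\<tau> (V - S) = \<tau>"
      proof
        fix x show "restrict ?\<tau> (V - S) x = \<tau> x" using PiE_arb[OF \<tau>, of x] by (auto simp: restrict_def)
      qed
      then show "((case ct of (c, \<tau>) \<Rightarrow> \<lambda>x. if x \<in> S then c else \<tau> x) v,
          restrict (case ct of (c, \<tau>) \<Rightarrow> \<lambda>x. if x \<in> S then c else \<tau> x) (V - S)) = ct"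
        using S(2) by simp
    qed
    also have "\<dots> = (\<Sum>c\<in>?C. col_exp p q E (V - S) (\<lambda>m. h (\<lambda>j. (if j = c then card S else 0) + m j)))"
      unfolding col_exp_def by (rule sum.cartesian_product[symmetric])
    finally show "(\<Sum>\<tau>\<in>PiE V (\<lambda>_. ?C). comp_prob p E V v S *
       (1 / real q * (if \<forall>x\<in>S. \<tau> x = \<tau> v then ?K (V - S) \<tau> else 0)) * h (?n V \<tau>)) =
      comp_prob p E V v S * (1 / real q * (\<Sum>c\<in>?C. col_exp p q E (V - S) (\<lambda>m. h (\<lambda>j. (if j = c then card S else 0) + m j))))" .
  qed
  finally show ?thesis .
qed

text \<open>Each exploration step preserves total mass: the component has some value S, and the q
  colours have weight 1 / q each. The rows of the Swendsen-Wang kernel therefore add up to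
  1.\<close>

lemma col_exp_one:
  assumes "finite V" "q \<ge> 1"
  shows "col_exp p q E V (\<lambda>_. 1) = 1"
  using assms(1)
proof (induction V rule: finite_psubset_induct)
  case (psubset V)
  show ?case
  proof (cases "V = {}")
    case True then show ?thesis by (simp add: col_exp_empty)
  next
    case False
    then obtain v where v: "v \<in> V" by auto
    have "col_exp p q E V (\<lambda>_. 1) = (\<Sum>S | S \<subseteq> V \<and> v \<in> S. comp_prob p E V v S)"
      unfolding col_exp_rec[OF psubset(1) v, of p q E "\<lambda>_. 1"]
    proof (intro sum.cong refl)
      fix S assume "S \<in> {S. S \<subseteq> V \<and> v \<in> S}"
      then have "V - S \<subset> V" by auto
      then have "col_exp p q E (V - S) (\<lambda>_. 1) = 1" by (rule psubset.IH)
      then show "comp_prob p E V v S * (1 / real q * (\<Sum>c\<in>{0..<q}. col_exp p q E (V - S) (\<lambda>m. 1))) = comp_prob p E V v S"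
        using assms(2) by simp
    qed
    then show ?thesis using sum_comp_prob[OF psubset(1) v, of p E] by simp
  qed
qed

text \<open>If all colour classes are subcritical, the exploration of one component after the other makes
  \<open>exp (\<theta> m\<^sub>j - \<alpha> |explored|)\<close> a supermartingale.\<close>

lemma col_exp_subcritical:
  assumes p: "0 \<le> p" "p \<le> 1" and q: "q \<ge> 1" "j < q" and V: "V \<subseteq> {0..<n}"
    and drift: "\<And>k. 1 \<le> k \<Longrightarrow> real k \<le> K \<Longrightarrow> (\<Sum>t\<in>{1..k}. clique_comp (1 - p) k t *
        ((1 - 1 / real q) * exp (- \<alpha> * real t) + 1 / real q * exp ((\<theta> - \<alpha>) * real t))) \<le> 1"
    and K: "\<And>v. v \<in> V \<Longrightarrow> real (card {x \<in> V. \<sigma> x = \<sigma> v}) \<le> K"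
  shows "col_exp p q (allowed_edges n \<sigma>) V (\<lambda>m. exp (\<theta> * real (m j))) \<le> exp (\<alpha> * real (card V))"
proof -
  have "finite V" using V finite_subset by blast
  then show ?thesis using V K
  proof (induction V rule: finite_psubset_induct)
    case (psubset V)
    let ?E = "allowed_edges n \<sigma>"
    show ?case
    proof (cases "V = {}")
      case True then show ?thesis by (simp add: col_exp_empty)
    next
      case False
      then obtain v where v: "v \<in> V" by auto
      let ?k = "card {x \<in> V. \<sigma> x = \<sigma> v}"
      have k1: "?k \<ge> 1" using v psubset(1) by (auto simp: Suc_le_eq card_gt_0_iff)
      \<comment> \<open>The bound after a component of size t: with probability 1 / q it takes
        colour j and contributes exp (\<theta> t), and in either case t fewer vertices
        remain.\<close>
      define \<phi> where "\<phi> t = exp (\<alpha> * real (card V)) *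
        ((1 - 1 / real q) * exp (- \<alpha> * real t) + 1 / real q * exp ((\<theta> - \<alpha>) * real t))" for t
      have "col_exp p q ?E V (\<lambda>m. exp (\<theta> * real (m j))) \<le> (\<Sum>S | S \<subseteq> V \<and> v \<in> S. comp_prob p ?E V v S * \<phi> (card S))"
        unfolding col_exp_rec[OF psubset(1) v]
      proof (intro sum_mono mult_left_mono comp_prob_nonneg p)
        fix S assume "S \<in> {S. S \<subseteq> V \<and> v \<in> S}"
        then have S: "S \<subseteq> V" "v \<in> S" by auto
        have cS: "real (card (V - S)) = real (card V) - real (card S)"
          using S psubset(1) by (simp add: card_Diff_subset finite_subset card_mono of_nat_diff)
        have IH: "col_exp p q ?E (V - S) (\<lambda>m. exp (\<theta> * real (m j))) \<le> exp (\<alpha> * (real (card V) - real (card S)))"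
          unfolding cS[symmetric]
        proof (rule psubset.IH)
          show "V - S \<subset> V" using S by auto
          show "V - S \<subseteq> {0..<n}" using psubset.prems by auto
          fix x assume x: "x \<in> V - S"
          have "card {y \<in> V - S. \<sigma> y = \<sigma> x} \<le> card {y \<in> V. \<sigma> y = \<sigma> x}"
            using psubset(1) by (intro card_mono) auto
          then show "real (card {y \<in> V - S. \<sigma> y = \<sigma> x}) \<le> K" using psubset.prems(2)[of x] x by simp
        qed
        have "(\<Sum>c\<in>{0..<q}. col_exp p q ?E (V - S) (\<lambda>m. exp (\<theta> * real ((if j = c then card S else 0) + m j))))
          \<le> (\<Sum>c\<in>{0..<q}. (if c = j then exp (\<theta> * real (card S)) else 1) * exp (\<alpha> * (real (card V) - real (card S))))"
        proof (intro sum_mono)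
          fix c
          have "(\<lambda>m. exp (\<theta> * real ((if j = c then card S else 0) + m j))) =
            (\<lambda>m :: nat \<Rightarrow> nat. (if c = j then exp (\<theta> * real (card S)) else 1) * exp (\<theta> * real (m j)))"
            by (auto simp: fun_eq_iff exp_add[symmetric] algebra_simps)
          then have "col_exp p q ?E (V - S) (\<lambda>m. exp (\<theta> * real ((if j = c then card S else 0) + m j))) =
            (if c = j then exp (\<theta> * real (card S)) else 1) * col_exp p q ?E (V - S) (\<lambda>m. exp (\<theta> * real (m j)))"
            by (simp only: col_exp_cmult)
          also have "\<dots> \<le> (if c = j then exp (\<theta> * real (card S)) else 1) * exp (\<alpha> * (real (card V) - real (card S)))"
            using IH by (intro mult_left_mono) auto
          finally show "col_exp p q ?E (V - S) (\<lambda>m. exp (\<theta> * real ((if j = c then card S else 0) + m j))) \<le>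
            (if c = j then exp (\<theta> * real (card S)) else 1) * exp (\<alpha> * (real (card V) - real (card S)))" .
        qed
        also have "\<dots> = (exp (\<theta> * real (card S)) + (real q - 1)) * exp (\<alpha> * (real (card V) - real (card S)))"
        proof -
          have "(\<Sum>c\<in>{0..<q}. if c = j then exp (\<theta> * real (card S)) else 1) = exp (\<theta> * real (card S)) + (real q - 1)"
            using q by (subst sum.remove[of _ j]) (auto simp: of_nat_diff)
          then show ?thesis by (simp only: sum_distrib_right[symmetric])
        qed
        finally have "1 / real q * (\<Sum>c\<in>{0..<q}. col_exp p q ?E (V - S) (\<lambda>m. exp (\<theta> * real ((if j = c then card S else 0) + m j))))
          \<le> 1 / real q * ((exp (\<theta> * real (card S)) + (real q - 1)) * exp (\<alpha> * (real (card V) - real (card S))))"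
          by (intro mult_left_mono) auto
        also have "\<dots> = \<phi> (card S)"
        proof -
          have "exp (\<alpha> * (real (card V) - real (card S))) = exp (\<alpha> * real (card V)) * exp (- \<alpha> * real (card S))"
            "exp ((\<theta> - \<alpha>) * real (card S)) = exp (\<theta> * real (card S)) * exp (- \<alpha> * real (card S))"
            by (simp_all add: exp_add[symmetric] algebra_simps)
          moreover have "1 - 1 / real q = 1 / real q * (real q - 1)" using q by (simp add: field_simps)
          ultimately show ?thesis by (simp only: \<phi>_def) (simp only: distrib_left distrib_right mult_ac add_ac)
        qed
        finally show "1 / real q * (\<Sum>c\<in>{0..<q}. col_exp p q ?E (V - S) (\<lambda>m. exp (\<theta> * real ((if j = c then card S else 0) + m j))))
          \<le> \<phi> (card S)" .
      qed
      also have "\<dots> = (\<Sum>t\<in>{1..?k}. clique_comp (1 - p) ?k t * \<phi> t)"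
        using psubset.prems v by (intro sum_comp_prob_card) auto
      also have "\<dots> = exp (\<alpha> * real (card V)) * (\<Sum>t\<in>{1..?k}. clique_comp (1 - p) ?k t *
        ((1 - 1 / real q) * exp (- \<alpha> * real t) + 1 / real q * exp ((\<theta> - \<alpha>) * real t)))"
        unfolding \<phi>_def sum_distrib_left by (simp only: mult_ac)
      also have "\<dots> \<le> exp (\<alpha> * real (card V)) * 1"
        using drift[OF k1] psubset.prems(2)[OF v] by (intro mult_left_mono) auto
      finally show ?thesis by simp
    qed
  qed
qed

text \<open>The negation, which defines the ordered trap, leaves the dominant colour open: the giant
  is recoloured uniformly in every step, so a trap with a prescribed dominant colour would not hold
  the chain.\<close>

definition no_majority :: "nat \<Rightarrow> real \<Rightarrow> (nat \<Rightarrow> nat) \<Rightarrow> bool" where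
  "no_majority q b m \<longleftrightarrow> (\<forall>c<q. \<exists>j<q. j \<noteq> c \<and> b < real (m j))"

text \<open>The components of the vertices of the largest colour class \<open>i\<close> are explored first. As long as the unexplored
  part \<open>k\<close> of this class is large, either a giant component is found, which leaves a subcritical graph,
  or \<open>exp (- \<kappa> k)\<close> decreases on average. The vector \<open>s\<close> counts the colours of the explored vertices.\<close>

lemma col_exp_no_majority:
  fixes \<rho> \<rho>' v lam b :: real and s :: "nat \<Rightarrow> nat"
  assumes p: "0 \<le> p" "p \<le> 1" and q: "q \<ge> 1" and lam: "lam > 0" and U: "U \<subseteq> {0..<n}"
    and drift: "\<And>k. 1 \<le> k \<Longrightarrow> lam * real k \<le> \<rho>' * real n \<Longrightarrow> (\<Sum>t\<in>{1..k}. clique_comp (1 - p) k t *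
        ((1 - 1 / real q) * exp (- \<alpha> * real t) + 1 / real q * exp ((\<theta> - \<alpha>) * real t))) \<le> 1"
    and super: "\<And>k. k \<le> n \<Longrightarrow> (v + \<rho>) * real n \<le> lam * real k \<Longrightarrow>
      (\<Sum>t | t \<in> {1..k} \<and> \<rho> * real n < lam * (real k - real t).
       clique_comp (1 - p) k t * exp (\<kappa> * real t)) \<le> exp (- \<kappa>)"
    and \<rho>: "\<rho> \<le> \<rho>'" "0 < \<rho>" "0 < v" and \<theta>: "0 \<le> \<theta>" "\<theta> \<le> \<kappa>" "0 < \<kappa>" "0 \<le> \<alpha>"
    and K: "\<And>x. x \<in> U \<Longrightarrow> \<sigma> x \<noteq> i \<Longrightarrow> lam * real (card {y \<in> U. \<sigma> y = \<sigma> x}) \<le> \<rho>' * real n"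
    and D: "D = exp (- \<theta> * b + \<alpha> * ((1 - v / lam) * real n))" and M: "M = 1 / (1 - exp (- \<kappa>))"
  shows "col_exp p q (allowed_edges n \<sigma>) U (\<lambda>m. of_bool (no_majority q b (\<lambda>j. s j + m j)))
    \<le> M * D * (\<Sum>j\<in>{0..<q}. exp (\<theta> * real (s j)))
      + exp (- \<kappa> * (real (card {x \<in> U. \<sigma> x = i}) - (v + \<rho>) * real n / lam))"
proof -
  let ?E = "allowed_edges n \<sigma>"
  let ?base = "(v + \<rho>) * real n / lam"
  have D0: "D \<ge> 0" by (simp add: D)
  \<comment> \<open>M is the geometric series in exp (- \<kappa>): each further component explored
    before the giant costs one such factor.\<close>
  have eM: "1 + exp (- \<kappa>) * M = M" "M \<ge> 0" using \<theta> by (auto simp: M field_simps)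
  have "finite U" using U finite_subset by blast
  then show ?thesis using U K
  proof (induction U arbitrary: s rule: finite_psubset_induct)
    case (psubset U)
    let ?X = "\<lambda>U s. col_exp p q ?E U (\<lambda>m. of_bool (no_majority q b (\<lambda>j. s j + m j)))"
    let ?W = "{x \<in> U. \<sigma> x = i}"
    let ?k = "card ?W"
    define Z where "Z s = (\<Sum>j\<in>{0..<q}. exp (\<theta> * real (s j)))" for s :: "nat \<Rightarrow> nat"
    have Z0: "Z s \<ge> 0" for s by (simp add: Z_def sum_nonneg)
    have MDZ: "M * D * Z s \<ge> 0" for s using eM(2) D0 Z0 by simp
    have kn: "?k \<le> n"
      using card_mono[of "{0..<n}" ?W] psubset.prems(1) by auto
    show ?case
    proof (cases "real ?k < ?base")
      case True
      have "?X U s \<le> col_exp p q ?E U (\<lambda>_. 1)" by (intro col_exp_mono p) auto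
      also have "\<dots> = 1" using psubset(1) q by (rule col_exp_one)
      also have "1 \<le> exp (- \<kappa> * (real ?k - ?base))" using True \<theta> by (simp add: mult_le_0_iff)
      finally show ?thesis using MDZ[of s] unfolding Z_def by linarith
    next
      case False
      then have kk: "(v + \<rho>) * real n \<le> lam * real ?k" using lam by (simp add: field_simps)
      define A where "A = exp (- \<kappa> * (real ?k - ?base))"
      show ?thesis
      \<comment> \<open>A class above the threshold can be empty only for n = 0.\<close>
      proof (cases "?W = {}")
        case True
        then have c0: "?k = 0" by (simp only: card.empty)
        then have "(v + \<rho>) * real n \<le> 0" using kk by simp
        then have "n = 0" using \<rho> by (simp add: mult_le_0_iff)
        then have "U = {}" using psubset.prems(1) by auto
        have "?X U s \<le> 1" unfolding \<open>U = {}\<close> col_exp_empty by simp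
        also have "1 = A" unfolding A_def c0 \<open>n = 0\<close> by simp
        finally show ?thesis using MDZ[of s] unfolding A_def Z_def by linarith
      next
        case False
        then obtain x where x: "x \<in> U" "\<sigma> x = i" by auto
        \<comment> \<open>A component is big when its removal leaves class i subcritical.\<close>
        define big where "big t \<longleftrightarrow> \<not> \<rho> * real n < lam * (real ?k - real t)" for t :: nat
        define \<phi> where "\<phi> t = D * Z s * of_bool (big t) +
          exp (\<kappa> * real t) * (M * D * Z s + A) * of_bool (\<not> big t)" for t :: nat
        have "?X U s \<le> (\<Sum>S | S \<subseteq> U \<and> x \<in> S. comp_prob p ?E U x S * \<phi> (card S))"
          unfolding col_exp_rec[OF psubset(1) x(1)]
        proof (intro sum_mono)
          fix S assume "S \<in> {S. S \<subseteq> U \<and> x \<in> S}"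
          then have S: "S \<subseteq> U" "x \<in> S" by auto
          have finS: "finite S" using S psubset(1) finite_subset by blast
          let ?s = "\<lambda>c j. s j + (if j = c then card S else 0)"
          have sh: "s j + ((if j = c then card S else 0) + m j) = ?s c j + m j" for c j and m :: "nat \<Rightarrow> nat" by simp
          show "comp_prob p ?E U x S * (1 / real q * (\<Sum>c\<in>{0..<q}. col_exp p q ?E (U - S)
              (\<lambda>m. of_bool (no_majority q b (\<lambda>j. s j + ((if j = c then card S else 0) + m j))))))
            \<le> comp_prob p ?E U x S * \<phi> (card S)"
          proof (cases "\<forall>y\<in>S. \<sigma> y = \<sigma> x")
            case False
            then show ?thesis by (simp add: comp_prob_def conn_prob_outside_class)
          next
            case True
            then have SW: "S \<subseteq> ?W" using S x by auto
            have cW: "real (card {y \<in> U - S. \<sigma> y = i}) = real ?k - real (card S)"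
            proof -
              have "{y \<in> U - S. \<sigma> y = i} = ?W - S" by auto
              then show ?thesis using SW finS psubset(1) by (simp add: card_Diff_subset card_mono of_nat_diff)
            qed
            have sub: "card {y \<in> U - S. \<sigma> y = \<sigma> z} \<le> card {y \<in> U. \<sigma> y = \<sigma> z}" for z
              using psubset(1) by (intro card_mono) auto
            have bnd: "?X (U - S) (?s c) \<le> D * Z s * of_bool (big (card S)) +
              (M * D * Z (?s c) + exp (\<kappa> * real (card S)) * A) * of_bool (\<not> big (card S))" if c: "c \<in> {0..<q}" for c
            proof (cases "big (card S)")
              case False
              have "?X (U - S) (?s c) \<le> M * D * (\<Sum>j\<in>{0..<q}. exp (\<theta> * real (?s c j)))
                  + exp (- \<kappa> * (real (card {y \<in> U - S. \<sigma> y = i}) - ?base))"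
              proof (rule psubset.IH)
                show "U - S \<subset> U" using S by auto
                show "U - S \<subseteq> {0..<n}" using psubset.prems(1) by auto
                fix z assume z: "z \<in> U - S" "\<sigma> z \<noteq> i"
                have "lam * real (card {y \<in> U - S. \<sigma> y = \<sigma> z}) \<le> lam * real (card {y \<in> U. \<sigma> y = \<sigma> z})"
                  using sub[of z] lam by (intro mult_left_mono) auto
                also have "\<dots> \<le> \<rho>' * real n" using psubset.prems(2) z by auto
                finally show "lam * real (card {y \<in> U - S. \<sigma> y = \<sigma> z}) \<le> \<rho>' * real n" .
              qed
              also have "exp (- \<kappa> * (real (card {y \<in> U - S. \<sigma> y = i}) - ?base)) = exp (\<kappa> * real (card S)) * A"
                unfolding cW A_def by (simp add: exp_add[symmetric] algebra_simps)
              finally show ?thesis using False by (simp add: Z_def)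
            next
              case True
              \<comment> \<open>The colour c of the giant is the candidate for the majority. Failure
                requires some j different from c above b, so the union bound and Markov's inequality
                only involve counts to which the giant does not contribute.\<close>
              have "?X (U - S) (?s c) \<le> col_exp p q ?E (U - S)
                  (\<lambda>m. \<Sum>j\<in>{0..<q} - {c}. exp (\<theta> * (real (s j) - b)) * exp (\<theta> * real (m j)))"
              proof (intro col_exp_mono p)
                fix m :: "nat \<Rightarrow> nat"
                show "of_bool (no_majority q b (\<lambda>j. ?s c j + m j)) \<le>
                  (\<Sum>j\<in>{0..<q} - {c}. exp (\<theta> * (real (s j) - b)) * exp (\<theta> * real (m j)))"
                proof (cases "no_majority q b (\<lambda>j. ?s c j + m j)")
                  case True
                  then obtain j where j: "j < q" "j \<noteq> c" "b < real (?s c j + m j)"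
                    using c unfolding no_majority_def by auto
                  have "0 \<le> \<theta> * (real (s j) - b + real (m j))" using j \<theta> by (intro mult_nonneg_nonneg) auto
                  then have "1 \<le> exp (\<theta> * (real (s j) - b + real (m j)))" by simp
                  also have "\<dots> = exp (\<theta> * (real (s j) - b)) * exp (\<theta> * real (m j))"
                    by (simp only: exp_add[symmetric] distrib_left)
                  also have "\<dots> \<le> (\<Sum>j\<in>{0..<q} - {c}. exp (\<theta> * (real (s j) - b)) * exp (\<theta> * real (m j)))"
                    using j by (intro member_le_sum) auto
                  finally show ?thesis by simp
                qed (simp add: sum_nonneg)
              qed
              also have "\<dots> = (\<Sum>j\<in>{0..<q} - {c}. exp (\<theta> * (real (s j) - b)) *
                  col_exp p q ?E (U - S) (\<lambda>m. exp (\<theta> * real (m j))))"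
                by (simp only: col_exp_sum col_exp_cmult)
              also have "\<dots> \<le> (\<Sum>j\<in>{0..<q} - {c}. exp (\<theta> * (real (s j) - b)) *
                  exp (\<alpha> * ((1 - v / lam) * real n)))"
              proof (intro sum_mono mult_left_mono)
                fix j assume "j \<in> {0..<q} - {c}"
                then have "col_exp p q ?E (U - S) (\<lambda>m. exp (\<theta> * real (m j))) \<le> exp (\<alpha> * real (card (U - S)))"
                proof (intro col_exp_subcritical[where K = "\<rho>' * real n / lam"] p q)
                  show "U - S \<subseteq> {0..<n}" using psubset.prems(1) by auto
                  fix k :: nat assume k: "1 \<le> k" "real k \<le> \<rho>' * real n / lam"
                  have "lam * real k \<le> \<rho>' * real n" using k(2) lam by (simp add: field_simps)
                  then show "(\<Sum>t\<in>{1..k}. clique_comp (1 - p) k t *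
                    ((1 - 1 / real q) * exp (- \<alpha> * real t) + 1 / real q * exp ((\<theta> - \<alpha>) * real t))) \<le> 1"
                    by (rule drift[OF k(1)])
                next
                  fix z assume z: "z \<in> U - S"
                  have "lam * real (card {y \<in> U - S. \<sigma> y = \<sigma> z}) \<le> \<rho>' * real n"
                  proof (cases "\<sigma> z = i")
                    case False
                    have "lam * real (card {y \<in> U - S. \<sigma> y = \<sigma> z}) \<le> lam * real (card {y \<in> U. \<sigma> y = \<sigma> z})"
                      using sub[of z] lam by (intro mult_left_mono) auto
                    also have "\<dots> \<le> \<rho>' * real n" using psubset.prems(2) z False by auto
                    finally show ?thesis .
                  next
                    case zi: True
                    have "lam * (real ?k - real (card S)) \<le> \<rho> * real n" using True by (simp add: big_def)
                    also have "\<dots> \<le> \<rho>' * real n" using \<rho> by (intro mult_right_mono) auto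
                    finally show ?thesis unfolding zi cW .
                  qed
                  then show "real (card {y \<in> U - S. \<sigma> y = \<sigma> z}) \<le> \<rho>' * real n / lam" using lam by (simp add: field_simps)
                qed auto
                also have "\<dots> \<le> exp (\<alpha> * ((1 - v / lam) * real n))"
                proof -
                  have "lam * (real ?k - real (card S)) \<le> \<rho> * real n" using True by (simp add: big_def)
                  \<comment> \<open>At least (v + \<rho>) n / lam vertices of the class were present
                    and at most \<rho> n / lam remain; the giant accounts for the
                    difference.\<close>
                  then have "v * real n \<le> lam * real (card S)" using kk by (simp add: algebra_simps)
                  then have "v * real n / lam \<le> real (card S)" using lam by (simp add: field_simps)
                  moreover have "real (card (U - S)) = real (card U) - real (card S)"
                    using S psubset(1) by (simp add: card_Diff_subset finS card_mono of_nat_diff)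
                  moreover have "card U \<le> n" using card_mono[of "{0..<n}" U] psubset.prems(1) by simp
                  ultimately have "real (card (U - S)) \<le> (1 - v / lam) * real n" by (simp add: algebra_simps)
                  then show ?thesis using \<theta> by (simp add: mult_left_mono)
                qed
                finally show "col_exp p q ?E (U - S) (\<lambda>m. exp (\<theta> * real (m j))) \<le> exp (\<alpha> * ((1 - v / lam) * real n))" .
              qed simp
              also have "\<dots> \<le> (\<Sum>j\<in>{0..<q}. exp (\<theta> * (real (s j) - b)) * exp (\<alpha> * ((1 - v / lam) * real n)))"
                by (intro sum_mono2) auto
              also have "\<dots> = D * Z s"
                unfolding Z_def D sum_distrib_left by (simp add: exp_add[symmetric] algebra_simps)
              finally show ?thesis using True by simp
            qed
            \<comment> \<open>\<theta> is at most \<kappa>, so a component that is not big inflates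
              Z by no more than the factor exp (\<kappa> t) that it costs in A.\<close>
            have Zs: "Z (?s c) \<le> exp (\<kappa> * real (card S)) * Z s" for c
              unfolding Z_def sum_distrib_left
            proof (intro sum_mono)
              fix j
              have "\<theta> * real (if j = c then card S else 0) \<le> \<kappa> * real (card S)"
                using \<theta> by (auto intro: mult_right_mono)
              then show "exp (\<theta> * real (?s c j)) \<le> exp (\<kappa> * real (card S)) * exp (\<theta> * real (s j))"
                by (simp add: exp_add[symmetric] algebra_simps)
            qed
            have "?X (U - S) (?s c) \<le> \<phi> (card S)" if c: "c \<in> {0..<q}" for c
            proof -
              have "M * D * Z (?s c) \<le> M * D * (exp (\<kappa> * real (card S)) * Z s)"
                using Zs[of c] eM D0 by (intro mult_left_mono) auto
              then have "M * D * Z (?s c) + exp (\<kappa> * real (card S)) * A \<le> exp (\<kappa> * real (card S)) * (M * D * Z s + A)"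
                by (simp add: algebra_simps)
              then show ?thesis using bnd[OF c] by (cases "big (card S)") (auto simp: \<phi>_def)
            qed
            then have "(\<Sum>c\<in>{0..<q}. ?X (U - S) (?s c)) \<le> real (card {0..<q}) * \<phi> (card S)"
              by (rule sum_bounded_above)
            then have "1 / real q * (\<Sum>c\<in>{0..<q}. ?X (U - S) (?s c)) \<le> \<phi> (card S)"
              using q by (simp add: field_simps)
            then show ?thesis unfolding sh by (intro mult_left_mono comp_prob_nonneg p)
          qed
        qed
        also have "\<dots> = (\<Sum>t\<in>{1..?k}. clique_comp (1 - p) ?k t * \<phi> t)"
          using psubset.prems(1) x by (subst sum_comp_prob_card) auto
        also have "\<dots> = D * Z s * (\<Sum>t\<in>{1..?k}. clique_comp (1 - p) ?k t * of_bool (big t)) +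
          (M * D * Z s + A) * (\<Sum>t\<in>{1..?k}. clique_comp (1 - p) ?k t * exp (\<kappa> * real t) * of_bool (\<not> big t))"
          unfolding \<phi>_def sum_distrib_left sum.distrib[symmetric] by (intro sum.cong refl) (simp add: algebra_simps)
        also have "\<dots> \<le> D * Z s * 1 + (M * D * Z s + A) * exp (- \<kappa>)"
        proof (intro add_mono mult_left_mono)
          have "(\<Sum>t\<in>{1..?k}. clique_comp (1 - p) ?k t * of_bool (big t)) \<le> (\<Sum>t\<in>{1..?k}. clique_comp (1 - p) ?k t)"
            using p by (intro sum_mono) (auto simp: mult_left_le clique_comp_nonneg)
          also have "\<dots> = 1" using x psubset(1) by (intro sum_clique_comp) (auto simp: Suc_le_eq card_gt_0_iff)
          finally show "(\<Sum>t\<in>{1..?k}. clique_comp (1 - p) ?k t * of_bool (big t)) \<le> 1" .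
          have "(\<Sum>t\<in>{1..?k}. clique_comp (1 - p) ?k t * exp (\<kappa> * real t) * of_bool (\<not> big t)) =
            (\<Sum>t | t \<in> {1..?k} \<and> \<rho> * real n < lam * (real ?k - real t). clique_comp (1 - p) ?k t * exp (\<kappa> * real t))"
            by (intro sum.mono_neutral_cong_right) (auto simp: big_def)
          also have "\<dots> \<le> exp (- \<kappa>)" by (rule super[OF kn kk])
          finally show "(\<Sum>t\<in>{1..?k}. clique_comp (1 - p) ?k t * exp (\<kappa> * real t) * of_bool (\<not> big t)) \<le> exp (- \<kappa>)" .
          show "0 \<le> M * D * Z s + A" using eM D0 Z0[of s] by (simp add: A_def)
        qed (use D0 Z0 in auto)
        also have "\<dots> = (1 + exp (- \<kappa>) * M) * D * Z s + exp (- \<kappa>) * A" by (simp add: algebra_simps)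
        also have "\<dots> \<le> M * D * Z s + A"
        proof -
          have "exp (- \<kappa>) * A \<le> 1 * A" using \<theta> by (intro mult_right_mono) (auto simp: A_def)
          then show ?thesis unfolding eM(1) by simp
        qed
        finally show ?thesis unfolding A_def Z_def .
      qed
    qed
  qed
qed

section \<open>Mixing times of chains with two traps\<close>

lemma mat_pow_nonneg:
  assumes "\<And>x y. x \<in> S \<Longrightarrow> y \<in> S \<Longrightarrow> 0 \<le> P x y" "y \<in> S"
  shows "0 \<le> mat_pow S P t x y"
  using assms(2)
proof (induction t arbitrary: y)
  case (Suc t)
  then show ?case by (auto intro!: sum_nonneg mult_nonneg_nonneg intro: assms(1))
qed simp

lemma sum_mat_pow:
  assumes "finite S" "\<And>x. x \<in> S \<Longrightarrow> (\<Sum>y\<in>S. P x y) = 1" "x \<in> S"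
  shows "(\<Sum>y\<in>S. mat_pow S P t x y) = 1"
proof (induction t)
  case 0 then show ?case using assms by simp
next
  case (Suc t)
  have "(\<Sum>y\<in>S. mat_pow S P (Suc t) x y) = (\<Sum>z\<in>S. \<Sum>y\<in>S. mat_pow S P t x z * P z y)"
    unfolding mat_pow.simps by (rule sum.swap)
  also have "\<dots> = (\<Sum>z\<in>S. mat_pow S P t x z)"
    by (intro sum.cong refl) (simp add: sum_distrib_left[symmetric] assms(2))
  finally show ?case using Suc by simp
qed

text \<open>Mass that is already outside counts in full, whether or not it returns; the mass inside,
  at most 1, adds at most \<epsilon> per step.\<close>

lemma mat_pow_escape:
  assumes S: "finite S" "A \<subseteq> S" "x \<in> A"
    and P: "\<And>x y. x \<in> S \<Longrightarrow> y \<in> S \<Longrightarrow> 0 \<le> P x y" "\<And>x. x \<in> S \<Longrightarrow> (\<Sum>y\<in>S. P x y) = 1"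
    and e: "\<And>x. x \<in> A \<Longrightarrow> (\<Sum>y\<in>S - A. P x y) \<le> \<epsilon>" and e0: "0 \<le> \<epsilon>"
  shows "(\<Sum>y\<in>S - A. mat_pow S P t x y) \<le> real t * \<epsilon>"
proof (induction t)
  case 0
  have "(\<Sum>y\<in>S - A. mat_pow S P 0 x y) = 0" using S by (intro sum.neutral) auto
  then show ?case by simp
next
  case (Suc t)
  have xS: "x \<in> S" using S by auto
  have nn: "0 \<le> mat_pow S P t x z" if "z \<in> S" for z
    by (rule mat_pow_nonneg) (use P that in auto)
  have out: "(\<Sum>y\<in>S - A. P z y) \<le> 1" if "z \<in> S" for z
  proof -
    have "(\<Sum>y\<in>S - A. P z y) \<le> (\<Sum>y\<in>S. P z y)" using S P that by (intro sum_mono2) auto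
    then show ?thesis using P(2) that by simp
  qed
  have "(\<Sum>y\<in>S - A. mat_pow S P (Suc t) x y) = (\<Sum>z\<in>S. \<Sum>y\<in>S - A. mat_pow S P t x z * P z y)"
    unfolding mat_pow.simps by (rule sum.swap)
  also have "\<dots> = (\<Sum>z\<in>S. mat_pow S P t x z * (\<Sum>y\<in>S - A. P z y))" by (simp add: sum_distrib_left)
  also have "\<dots> = (\<Sum>z\<in>S - A. mat_pow S P t x z * (\<Sum>y\<in>S - A. P z y))
      + (\<Sum>z\<in>A. mat_pow S P t x z * (\<Sum>y\<in>S - A. P z y))"
    using S by (subst sum.subset_diff[of A S]) auto
  also have "\<dots> \<le> (\<Sum>z\<in>S - A. mat_pow S P t x z * 1) + (\<Sum>z\<in>A. mat_pow S P t x z * \<epsilon>)"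
    using S(2) out e nn by (intro add_mono sum_mono mult_left_mono) auto
  also have "\<dots> \<le> real t * \<epsilon> + 1 * \<epsilon>"
  proof -
    have "(\<Sum>z\<in>A. mat_pow S P t x z) \<le> (\<Sum>z\<in>S. mat_pow S P t x z)"
      using S nn by (intro sum_mono2) auto
    also have "\<dots> = 1" by (rule sum_mat_pow) (use S P xS in auto)
    finally have "(\<Sum>z\<in>A. mat_pow S P t x z * \<epsilon>) \<le> 1 * \<epsilon>"
      unfolding sum_distrib_right[symmetric] using e0 by (rule mult_right_mono)
    then show ?thesis using Suc by simp
  qed
  finally show ?case by (simp add: algebra_simps)
qed

lemma abs_sum_diff_le_tv_dist:
  assumes "finite S" "A \<subseteq> S"
  shows "\<bar>(\<Sum>x\<in>A. \<nu> x) - (\<Sum>x\<in>A. \<pi> x)\<bar> \<le> tv_dist S \<nu> \<pi>"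
proof -
  have "{\<bar>(\<Sum>x\<in>A. \<nu> x) - (\<Sum>x\<in>A. \<pi> x)\<bar> | A. A \<subseteq> S} = (\<lambda>A. \<bar>(\<Sum>x\<in>A. \<nu> x) - (\<Sum>x\<in>A. \<pi> x)\<bar>) ` Pow S"
    by auto
  then have "finite {\<bar>(\<Sum>x\<in>A. \<nu> x) - (\<Sum>x\<in>A. \<pi> x)\<bar> | A. A \<subseteq> S}" using assms by simp
  then show ?thesis unfolding tv_dist_def using assms by (intro Max_ge) auto
qed

text \<open>Every admissible time is at least R, hence at least its ceiling. As a lower bound for an
  infimum this includes the value infinity.\<close>

lemma mixing_time_geI:
  assumes "\<And>t. real t < R \<Longrightarrow> \<exists>x\<in>S. \<not> tv_dist S (mat_pow S P t x) \<pi> < 1 / (2 * exp 1)"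
  shows "ereal R \<le> ereal_of_enat (mixing_time S P \<pi>)"
proof -
  have "enat (nat \<lceil>R\<rceil>) \<le> mixing_time S P \<pi>"
    unfolding mixing_time_def
  proof (rule INF_greatest)
    fix t assume "t \<in> {t. \<forall>x\<in>S. tv_dist S (mat_pow S P t x) \<pi> < 1 / (2 * exp 1)}"
    then have "R \<le> real t" using assms[of t] by force
    then show "enat (nat \<lceil>R\<rceil>) \<le> enat t" by (simp add: ceiling_le_iff)
  qed
  then have "ereal_of_enat (enat (nat \<lceil>R\<rceil>)) \<le> ereal_of_enat (mixing_time S P \<pi>)"
    by (simp only: ereal_of_enat_le_iff)
  moreover have "ereal R \<le> ereal_of_enat (enat (nat \<lceil>R\<rceil>))" by (simp add: real_nat_ceiling_ge)
  ultimately show ?thesis by (rule order_trans[rotated])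
qed

text \<open>A chain that is started in either of two disjoint traps is still there after many steps. The
  stationary distribution would have to put mass greater than \<open>1/2\<close> on both.\<close>

lemma mixing_time_two_traps:
  assumes S: "finite S" "A \<subseteq> S" "B \<subseteq> S" "A \<inter> B = {}" "A \<noteq> {}" "B \<noteq> {}"
    and P: "\<And>x y. x \<in> S \<Longrightarrow> y \<in> S \<Longrightarrow> 0 \<le> P x y" "\<And>x. x \<in> S \<Longrightarrow> (\<Sum>y\<in>S. P x y) = 1"
    and \<pi>: "\<And>x. x \<in> S \<Longrightarrow> 0 \<le> \<pi> x" "(\<Sum>x\<in>S. \<pi> x) = 1"
    and eA: "\<And>x. x \<in> A \<Longrightarrow> (\<Sum>y\<in>S - A. P x y) \<le> \<epsilon>"
    and eB: "\<And>x. x \<in> B \<Longrightarrow> (\<Sum>y\<in>S - B. P x y) \<le> \<epsilon>"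
    and e0: "0 < \<epsilon>"
  shows "ereal (1 / (4 * \<epsilon>)) \<le> ereal_of_enat (mixing_time S P \<pi>)"
proof (rule mixing_time_geI, rule ccontr)
  fix t assume t: "real t < 1 / (4 * \<epsilon>)"
    and "\<not> (\<exists>x\<in>S. \<not> tv_dist S (mat_pow S P t x) \<pi> < 1 / (2 * exp 1))"
  then have tv: "tv_dist S (mat_pow S P t x) \<pi> < 1 / (2 * exp 1)" if "x \<in> S" for x using that by blast
  have te: "real t * \<epsilon> < 1 / 4" using t e0 by (simp add: field_simps)
  \<comment> \<open>From exp 1 at least 2. A trap that keeps more than 3/4 of the mass then has
    stationary mass greater than 1/2.\<close>
  have e: "1 / (2 * exp 1) \<le> (1 / 4 :: real)" using exp_ge_add_one_self[of "1 :: real"] by (simp add: field_simps)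
  have half: "(\<Sum>y\<in>C. \<pi> y) > 1 / 2" if C: "C \<subseteq> S" "C \<noteq> {}" "\<And>x. x \<in> C \<Longrightarrow> (\<Sum>y\<in>S - C. P x y) \<le> \<epsilon>" for C
  proof -
    obtain x where x: "x \<in> C" using C by auto
    have 1: "(\<Sum>y\<in>S - C. mat_pow S P t x y) \<le> real t * \<epsilon>"
      by (rule mat_pow_escape) (use S C P x e0 in auto)
    have "(\<Sum>y\<in>S. mat_pow S P t x y) = 1" by (rule sum_mat_pow) (use S P C x in auto)
    then have "(\<Sum>y\<in>S - C. mat_pow S P t x y) + (\<Sum>y\<in>C. mat_pow S P t x y) = 1"
      using S C by (subst (asm) sum.subset_diff[of C S]) auto
    then have 2: "(\<Sum>y\<in>C. mat_pow S P t x y) > 3 / 4" using 1 te by linarith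
    have "\<bar>(\<Sum>y\<in>C. mat_pow S P t x y) - (\<Sum>y\<in>C. \<pi> y)\<bar> \<le> tv_dist S (mat_pow S P t x) \<pi>"
      using S C by (intro abs_sum_diff_le_tv_dist) auto
    also have "\<dots> < 1 / (2 * exp 1)" using tv x C by auto
    finally show ?thesis using 2 e by linarith
  qed
  have "(\<Sum>y\<in>A. \<pi> y) + (\<Sum>y\<in>B. \<pi> y) = (\<Sum>y\<in>A \<union> B. \<pi> y)"
    using finite_subset[OF S(2,1)] finite_subset[OF S(3,1)] S(4) by (rule sum.union_disjoint[symmetric])
  also have "\<dots> \<le> (\<Sum>y\<in>S. \<pi> y)" using S \<pi> by (intro sum_mono2) auto
  finally show False using half[OF S(2,5) eA] half[OF S(3,6) eB] \<pi>(2) by linarith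
qed

lemma finite_configs [simp]: "finite (configs n q)"
  by (simp add: configs_def finite_PiE)

lemma potts_nonneg: "0 \<le> potts n q \<beta> \<sigma>"
  by (simp add: potts_def potts_weight_def sum_nonneg)

lemma sum_potts:
  assumes "q \<ge> 1"
  shows "(\<Sum>\<sigma>\<in>configs n q. potts n q \<beta> \<sigma>) = 1"
proof -
  have "configs n q \<noteq> {}" using assms by (auto simp: configs_def PiE_eq_empty_iff)
  then have "(\<Sum>\<tau>\<in>configs n q. potts_weight n \<beta> \<tau>) > 0"
    by (intro sum_pos) (auto simp: potts_weight_def)
  then show ?thesis by (simp add: potts_def sum_divide_distrib[symmetric])
qed

section \<open>The two phases of the Swendsen--Wang dynamics\<close>

text \<open>Estimates are carried out with rate 2 c; halving the rate pays for constant factors once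
  n is large.\<close>

lemma exp_absorb_const:
  fixes a c :: real
  assumes "c > 0" "real n \<ge> a / c"
  shows "a * exp (- (2 * c) * real n) \<le> exp (- c * real n)"
proof -
  have "a \<le> c * real n" using assms by (simp add: field_simps)
  then have "a \<le> exp (c * real n)" using exp_ge_add_one_self[of "c * real n"] by linarith
  then have "a * exp (- (2 * c) * real n) \<le> exp (c * real n) * exp (- (2 * c) * real n)"
    by (rule mult_right_mono) simp
  also have "\<dots> = exp (- c * real n)" by (simp add: exp_add[symmetric] algebra_simps)
  finally show ?thesis .
qed

text \<open>L and the range of \<theta> are uniform in n and k, and L is fixed before \<theta>. Both
  traps can therefore choose \<theta> small in terms of L and their own slack.\<close>

lemma subcritical_drift:
  fixes lam \<rho> :: real
  assumes lam: "0 < lam" and \<rho>: "0 < \<rho>" "\<rho> < 1" and q: "2 \<le> q"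
  shows "\<exists>L>0. \<exists>\<theta>0>0. \<exists>N. \<forall>\<theta> n k. 0 < \<theta> \<and> \<theta> \<le> \<theta>0 \<and> N \<le> n \<and> 1 \<le> k \<and> lam * real k \<le> \<rho> * real n \<longrightarrow>
    (\<Sum>t\<in>{1..k}. clique_comp (1 - lam / real n) k t *
      ((1 - 1 / real q) * exp (- (\<theta> / real q + L * \<theta>\<^sup>2) * real t)
        + 1 / real q * exp ((\<theta> - (\<theta> / real q + L * \<theta>\<^sup>2)) * real t))) \<le> 1"
proof -
  obtain c M N where c: "c > 0" and M: "\<And>n k. n \<ge> N \<Longrightarrow> k \<ge> 1 \<Longrightarrow> lam * real k \<le> \<rho> * real n \<Longrightarrow>
     (\<Sum>t\<in>{1..k}. clique_comp (1 - lam / real n) k t * exp (c * real t)) \<le> M"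
    using clique_comp_subcritical[OF lam \<rho>] by blast
  define L where "L = 8 * max M 1 / c\<^sup>2"
  have L: "L > 0" using c by (simp add: L_def)
  \<comment> \<open>The bound c / 2 is for the moment estimate. The bound 1 / (2 L) makes the
    quadratic term at most \<theta> / 2, and q at least 2 bounds the linear one in the same way, so
    that \<alpha> is at most \<theta>.\<close>
  define \<theta>0 where "\<theta>0 = min (c / 2) (1 / (2 * L))"
  have \<theta>0: "\<theta>0 > 0" using c L by (simp add: \<theta>0_def)
  define N' where "N' = max N (nat \<lceil>lam\<rceil>)"
  have "(\<Sum>t\<in>{1..k}. clique_comp (1 - lam / real n) k t *
      ((1 - 1 / real q) * exp (- (\<theta> / real q + L * \<theta>\<^sup>2) * real t)
        + 1 / real q * exp ((\<theta> - (\<theta> / real q + L * \<theta>\<^sup>2)) * real t))) \<le> 1"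
    if \<theta>: "0 < \<theta>" "\<theta> \<le> \<theta>0" and n: "N' \<le> n" and k: "1 \<le> k" "lam * real k \<le> \<rho> * real n" for \<theta> n k
  proof -
    have "real n \<ge> lam" "n \<ge> N" using n unfolding N'_def by linarith+
    then have r: "0 \<le> 1 - lam / real n" "1 - lam / real n \<le> 1" using lam by (auto simp: field_simps)
    show ?thesis
    proof (rule exp_moment_drift[where c = c and M = "max M 1" and L = L])
      show "(\<Sum>t\<in>{1..k}. clique_comp (1 - lam / real n) k t * exp (c * real t)) \<le> max M 1"
        using M[OF \<open>n \<ge> N\<close> k] by simp
      show "\<theta> \<le> c / 2" using \<theta> by (simp add: \<theta>0_def)
      have "\<theta> * L \<le> 1 / (2 * L) * L" using \<theta> L by (intro mult_right_mono) (auto simp: \<theta>0_def)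
      then have "L * \<theta> \<le> 1 / 2" using L by (simp add: mult.commute)
      then have "(L * \<theta>) * \<theta> \<le> 1 / 2 * \<theta>" using \<theta> by (intro mult_right_mono) auto
      moreover have "\<theta> / real q \<le> \<theta> / 2" using q \<theta> by (intro divide_left_mono) auto
      moreover have "L * \<theta>\<^sup>2 = (L * \<theta>) * \<theta>" by (simp add: power2_eq_square)
      ultimately show "\<theta> / real q + L * \<theta>\<^sup>2 \<le> \<theta>" by linarith
      show "(\<Sum>t\<in>{1..k}. clique_comp (1 - lam / real n) k t) = 1" using k by (intro sum_clique_comp)
    qed (use r \<theta> c q in \<open>auto simp: L_def intro: clique_comp_nonneg\<close>)
  qed
  then show ?thesis using L \<theta>0 by blast
qed

text \<open>All classes are subcritical as lam b < 1, so each new colour receives little more than n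
  / q vertices. Markov's inequality for the exponential moment gains from the gap between b and 1 /
  q.\<close>

lemma disordered_trap:
  fixes lam b :: real
  assumes lam: "0 < lam" and q: "2 \<le> q" and b: "1 / real q < b" "lam * b < 1"
  shows "\<exists>c>0. \<exists>N. \<forall>n\<ge>N. \<forall>\<sigma>. (\<forall>x<n. real (card {y \<in> {0..<n}. \<sigma> y = \<sigma> x}) \<le> b * real n) \<longrightarrow>
    col_exp (lam / real n) q (allowed_edges n \<sigma>) {0..<n} (\<lambda>m. of_bool (\<exists>j<q. b * real n < real (m j)))
      \<le> exp (- c * real n)"
proof -
  have b0: "0 < lam * b" using b lam q by (smt (verit) divide_nonneg_nonneg mult_pos_pos of_nat_0_le_iff)
  obtain L \<theta>0 N where L: "L > 0" and \<theta>0: "\<theta>0 > 0" and drift: "\<And>\<theta> n k. 0 < \<theta> \<Longrightarrow> \<theta> \<le> \<theta>0 \<Longrightarrow> N \<le> n \<Longrightarrow> 1 \<le> k \<Longrightarrow>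
     lam * real k \<le> lam * b * real n \<Longrightarrow> (\<Sum>t\<in>{1..k}. clique_comp (1 - lam / real n) k t *
      ((1 - 1 / real q) * exp (- (\<theta> / real q + L * \<theta>\<^sup>2) * real t)
        + 1 / real q * exp ((\<theta> - (\<theta> / real q + L * \<theta>\<^sup>2)) * real t))) \<le> 1"
    using subcritical_drift[OF lam b0 b(2) q] by blast
  define g where "g = b - 1 / real q"
  have g: "g > 0" using b by (simp add: g_def)
  \<comment> \<open>The quadratic term may consume only half of the gap g.\<close>
  define \<theta> where "\<theta> = min \<theta>0 (g / (2 * L))"
  have \<theta>: "0 < \<theta>" "\<theta> \<le> \<theta>0" "L * \<theta> \<le> g / 2" using \<theta>0 g L by (auto simp: \<theta>_def min_def field_simps)
  define \<alpha> where "\<alpha> = \<theta> / real q + L * \<theta>\<^sup>2"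
  define c where "c = \<theta> * g / 4"
  have c: "c > 0" using \<theta> g by (simp add: c_def)
  have \<alpha>: "\<alpha> - \<theta> * b \<le> - (2 * c)"
  proof -
    have "\<theta> * (L * \<theta>) \<le> \<theta> * (g / 2)" using \<theta> by (intro mult_left_mono) auto
    moreover have "\<alpha> - \<theta> * b = \<theta> * (L * \<theta>) - \<theta> * g" by (simp add: \<alpha>_def g_def algebra_simps power2_eq_square)
    ultimately show ?thesis by (simp add: c_def)
  qed
  define N' where "N' = max N (max (nat \<lceil>lam\<rceil>) (nat \<lceil>real q / c\<rceil>))"
  have "col_exp (lam / real n) q (allowed_edges n \<sigma>) {0..<n} (\<lambda>m. of_bool (\<exists>j<q. b * real n < real (m j)))
      \<le> exp (- c * real n)"
    if n: "n \<ge> N'" and \<sigma>: "\<forall>x<n. real (card {y \<in> {0..<n}. \<sigma> y = \<sigma> x}) \<le> b * real n" for n \<sigma>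
  proof -
    let ?p = "lam / real n" and ?E = "allowed_edges n \<sigma>"
    have nn: "real n \<ge> lam" "n \<ge> N" "real n \<ge> real q / c" using n unfolding N'_def by linarith+
    then have p: "0 \<le> ?p" "?p \<le> 1" using lam by (auto simp: field_simps)
    have "col_exp ?p q ?E {0..<n} (\<lambda>m. of_bool (\<exists>j<q. b * real n < real (m j)))
      \<le> col_exp ?p q ?E {0..<n} (\<lambda>m. \<Sum>j\<in>{0..<q}. exp (- \<theta> * b * real n) * exp (\<theta> * real (m j)))"
    proof (intro col_exp_mono p)
      fix m :: "nat \<Rightarrow> nat"
      show "of_bool (\<exists>j<q. b * real n < real (m j)) \<le> (\<Sum>j\<in>{0..<q}. exp (- \<theta> * b * real n) * exp (\<theta> * real (m j)))"
      proof (cases "\<exists>j<q. b * real n < real (m j)")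
        case True
        then obtain j where j: "j < q" "b * real n < real (m j)" by auto
        have "0 \<le> \<theta> * (real (m j) - b * real n)" using j \<theta> by (intro mult_nonneg_nonneg) auto
        then have "1 \<le> exp (\<theta> * (real (m j) - b * real n))" by simp
        also have "\<dots> = exp (- \<theta> * b * real n) * exp (\<theta> * real (m j))"
          by (simp add: exp_add[symmetric] algebra_simps)
        also have "\<dots> \<le> (\<Sum>j\<in>{0..<q}. exp (- \<theta> * b * real n) * exp (\<theta> * real (m j)))"
          using j by (intro member_le_sum) auto
        finally show ?thesis using True by simp
      qed (auto intro!: sum_nonneg)
    qed
    also have "\<dots> = (\<Sum>j\<in>{0..<q}. exp (- \<theta> * b * real n) * col_exp ?p q ?E {0..<n} (\<lambda>m. exp (\<theta> * real (m j))))"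
      by (simp only: col_exp_sum col_exp_cmult)
    also have "\<dots> \<le> (\<Sum>j\<in>{0..<q}. exp (- \<theta> * b * real n) * exp (\<alpha> * real (card {0..<n})))"
    proof (intro sum_mono mult_left_mono)
      fix j assume "j \<in> {0..<q}"
      then show "col_exp ?p q ?E {0..<n} (\<lambda>m. exp (\<theta> * real (m j))) \<le> exp (\<alpha> * real (card {0..<n}))"
      proof (intro col_exp_subcritical[where K = "b * real n"] p)
        fix k :: nat assume k: "1 \<le> k" "real k \<le> b * real n"
        have "lam * real k \<le> lam * b * real n" using k lam by simp
        then show "(\<Sum>t\<in>{1..k}. clique_comp (1 - ?p) k t *
            ((1 - 1 / real q) * exp (- \<alpha> * real t) + 1 / real q * exp ((\<theta> - \<alpha>) * real t))) \<le> 1"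
          unfolding \<alpha>_def by (intro drift \<theta> nn k)
      qed (use q \<sigma> in auto)
    qed simp
    also have "\<dots> = real q * exp ((\<alpha> - \<theta> * b) * real n)"
      by (simp add: exp_add[symmetric] algebra_simps)
    also have "\<dots> \<le> real q * exp (- (2 * c) * real n)"
      by (intro mult_left_mono iffD2[OF exp_le_cancel_iff] mult_right_mono \<alpha>) auto
    also have "\<dots> \<le> exp (- c * real n)" by (rule exp_absorb_const[OF c nn(3)])
    finally show ?thesis .
  qed
  then show ?thesis using c by blast
qed

text \<open>Once a giant of at least v n / lam vertices is found, at most (1 - v / lam) n vertices
  remain and are spread subcritically, about a fraction 1 / q to each colour, which stays below b n.
  The surplus \<delta> in the size of class i makes it exponentially unlikely that no giant is
  found.\<close>

lemma ordered_trap: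
  fixes lam v \<rho> \<delta> b :: real
  assumes lam: "0 < lam" and q: "2 \<le> q" and v: "0 < v" "v < lam" and \<rho>: "v < (\<rho> - \<delta>) * (exp v - 1)" "0 < \<rho>" "\<rho> < 1"
    and \<delta>: "0 < \<delta>" and b: "(1 - v / lam) / real q < b" "lam * b < 1"
  shows "\<exists>c>0. \<exists>N. \<forall>n\<ge>N. \<forall>\<sigma> i. (\<forall>x<n. \<sigma> x \<noteq> i \<longrightarrow> real (card {y \<in> {0..<n}. \<sigma> y = \<sigma> x}) \<le> b * real n) \<and>
      (v + \<rho> + \<delta>) * real n \<le> lam * real (card {y \<in> {0..<n}. \<sigma> y = i}) \<longrightarrow>
    col_exp (lam / real n) q (allowed_edges n \<sigma>) {0..<n} (\<lambda>m. of_bool (no_majority q (b * real n) m))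
      \<le> exp (- c * real n)"
proof -
  \<comment> \<open>One subcritical level for both the rest of class i after its giant, at most
    \<rho>, and the other classes, at most lam b.\<close>
  define \<rho>2 where "\<rho>2 = max \<rho> (lam * b)"
  have \<rho>2: "0 < \<rho>2" "\<rho>2 < 1" "\<rho> \<le> \<rho>2" "lam * b \<le> \<rho>2" using \<rho> b by (auto simp: \<rho>2_def)
  obtain L \<theta>0 N1 where L: "L > 0" and \<theta>0: "\<theta>0 > 0" and drift: "\<And>\<theta> n k. 0 < \<theta> \<Longrightarrow> \<theta> \<le> \<theta>0 \<Longrightarrow> N1 \<le> n \<Longrightarrow> 1 \<le> k \<Longrightarrow>
     lam * real k \<le> \<rho>2 * real n \<Longrightarrow> (\<Sum>t\<in>{1..k}. clique_comp (1 - lam / real n) k t *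
      ((1 - 1 / real q) * exp (- (\<theta> / real q + L * \<theta>\<^sup>2) * real t)
        + 1 / real q * exp ((\<theta> - (\<theta> / real q + L * \<theta>\<^sup>2)) * real t))) \<le> 1"
    using subcritical_drift[OF lam \<rho>2(1,2) q] by blast
  obtain \<kappa> N2 where \<kappa>: "\<kappa> > 0" and super: "\<And>n k. n \<ge> N2 \<Longrightarrow> k \<le> n \<Longrightarrow> (v + \<rho>) * real n \<le> lam * real k \<Longrightarrow>
    (\<Sum>t | t \<in> {1..k} \<and> \<rho> * real n < lam * (real k - real t).
       clique_comp (1 - lam / real n) k t * exp (\<kappa> * real t)) \<le> exp (- \<kappa>)"
    using clique_comp_supercritical[OF lam v(1) \<rho>(1) \<delta>] by blast
  define g where "g = b - (1 - v / lam) / real q"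
  have g: "g > 0" using b by (simp add: g_def)
  define \<theta> where "\<theta> = min (min \<theta>0 \<kappa>) (g / (2 * L))"
  have \<theta>: "0 < \<theta>" "\<theta> \<le> \<theta>0" "\<theta> \<le> \<kappa>" "\<theta> \<le> g / (2 * L)"
    using \<theta>0 g L \<kappa> by (simp_all add: \<theta>_def min_def)
  then have L\<theta>: "L * \<theta> \<le> g / 2" using L by (simp add: field_simps)
  define \<alpha> where "\<alpha> = \<theta> / real q + L * \<theta>\<^sup>2"
  have \<alpha>0: "0 \<le> \<alpha>" using \<theta> L by (simp add: \<alpha>_def)
  define M where "M = 1 / (1 - exp (- \<kappa>))"
  have M0: "M \<ge> 0" using \<kappa> by (simp add: M_def)
  \<comment> \<open>The two entries are the rates for another colour growing too large and for the
    missing giant.\<close>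
  define c where "c = min (\<theta> * g / 4) (\<kappa> * \<delta> / (2 * lam))"
  have c: "c > 0" using \<theta> g \<kappa> \<delta> lam by (simp add: c_def)
  have c2: "2 * c \<le> \<kappa> * \<delta> / lam" using min.cobounded2[of "\<theta> * g / 4" "\<kappa> * \<delta> / (2 * lam)"] by (simp add: c_def field_simps)
  have \<alpha>: "- \<theta> * b + \<alpha> * (1 - v / lam) \<le> - (2 * c)"
  proof -
    have "\<theta> * (L * \<theta>) \<le> \<theta> * (g / 2)" using L\<theta> \<theta>(1) by (intro mult_left_mono) auto
    moreover have "L * \<theta>\<^sup>2 * (1 - v / lam) \<le> L * \<theta>\<^sup>2 * 1" using L v lam by (intro mult_left_mono) auto
    moreover have "- \<theta> * b + \<alpha> * (1 - v / lam) = - (\<theta> * g) + L * \<theta>\<^sup>2 * (1 - v / lam)"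
      by (simp add: \<alpha>_def g_def algebra_simps diff_divide_distrib)
    ultimately have "- \<theta> * b + \<alpha> * (1 - v / lam) \<le> - (\<theta> * g / 2)"
      by (simp add: power2_eq_square mult_ac)
    also have "\<dots> \<le> - (2 * c)" by (simp add: c_def)
    finally show ?thesis .
  qed
  define N where "N = max (max N1 N2) (max (nat \<lceil>lam\<rceil>) (nat \<lceil>(M * real q + 1) / c\<rceil>))"
  have "col_exp (lam / real n) q (allowed_edges n \<sigma>) {0..<n} (\<lambda>m. of_bool (no_majority q (b * real n) m))
      \<le> exp (- c * real n)"
    if n: "n \<ge> N" and \<sigma>1: "\<And>x. x < n \<Longrightarrow> \<sigma> x \<noteq> i \<Longrightarrow> real (card {y \<in> {0..<n}. \<sigma> y = \<sigma> x}) \<le> b * real n"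
      and \<sigma>2: "(v + \<rho> + \<delta>) * real n \<le> lam * real (card {y \<in> {0..<n}. \<sigma> y = i})" for n \<sigma> i
  proof -
    let ?p = "lam / real n"
    have nn: "real n \<ge> lam" "n \<ge> N1" "n \<ge> N2" "real n \<ge> (M * real q + 1) / c" using n unfolding N_def by linarith+
    then have p: "0 \<le> ?p" "?p \<le> 1" using lam by (auto simp: field_simps)
    define D where "D = exp (- \<theta> * (b * real n) + \<alpha> * ((1 - v / lam) * real n))"
    have "col_exp ?p q (allowed_edges n \<sigma>) {0..<n} (\<lambda>m. of_bool (no_majority q (b * real n) (\<lambda>j. 0 + m j)))
      \<le> M * D * (\<Sum>j\<in>{0..<q}. exp (\<theta> * real 0))
        + exp (- \<kappa> * (real (card {x \<in> {0..<n}. \<sigma> x = i}) - (v + \<rho>) * real n / lam))"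
    proof (rule col_exp_no_majority[where \<rho>' = \<rho>2 and v = v and \<rho> = \<rho> and lam = lam and \<alpha> = \<alpha> and D = D])
      fix k :: nat assume k: "1 \<le> k" "lam * real k \<le> \<rho>2 * real n"
      show "(\<Sum>t\<in>{1..k}. clique_comp (1 - ?p) k t *
          ((1 - 1 / real q) * exp (- \<alpha> * real t) + 1 / real q * exp ((\<theta> - \<alpha>) * real t))) \<le> 1"
        unfolding \<alpha>_def by (intro drift \<theta> nn k)
    next
      fix k :: nat assume k: "k \<le> n" "(v + \<rho>) * real n \<le> lam * real k"
      show "(\<Sum>t | t \<in> {1..k} \<and> \<rho> * real n < lam * (real k - real t).
          clique_comp (1 - ?p) k t * exp (\<kappa> * real t)) \<le> exp (- \<kappa>)"
        by (rule super[OF nn(3) k])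
    next
      fix x assume x: "x \<in> {0..<n}" "\<sigma> x \<noteq> i"
      have "lam * real (card {y \<in> {0..<n}. \<sigma> y = \<sigma> x}) \<le> lam * (b * real n)"
        using \<sigma>1[of x] x lam by (intro mult_left_mono) auto
      also have "\<dots> \<le> \<rho>2 * real n" using \<rho>2 mult_right_mono[of "lam * b" \<rho>2 "real n"] by simp
      finally show "lam * real (card {y \<in> {0..<n}. \<sigma> y = \<sigma> x}) \<le> \<rho>2 * real n" .
    qed (use p q lam \<rho> \<rho>2 v \<theta> \<kappa> \<alpha>0 in \<open>auto simp: D_def M_def\<close>)
    also have "\<dots> \<le> M * exp (- (2 * c) * real n) * real q + exp (- (2 * c) * real n)"
    proof (intro add_mono)
      have "D = exp ((- \<theta> * b + \<alpha> * (1 - v / lam)) * real n)" by (simp add: D_def algebra_simps)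
      also have "\<dots> \<le> exp (- (2 * c) * real n)" by (intro iffD2[OF exp_le_cancel_iff] mult_right_mono \<alpha>) auto
      finally show "M * D * (\<Sum>j\<in>{0..<q}. exp (\<theta> * real 0)) \<le> M * exp (- (2 * c) * real n) * real q"
        using M0 by (simp add: mult_left_mono mult_right_mono)
      have "\<delta> * real n / lam \<le> real (card {x \<in> {0..<n}. \<sigma> x = i}) - (v + \<rho>) * real n / lam"
        using \<sigma>2 lam by (simp add: field_simps)
      then have "\<kappa> * (\<delta> * real n / lam) \<le> \<kappa> * (real (card {x \<in> {0..<n}. \<sigma> x = i}) - (v + \<rho>) * real n / lam)"
        using \<kappa> by (intro mult_left_mono) auto
      moreover have "2 * c * real n \<le> \<kappa> * \<delta> / lam * real n" using c2 by (rule mult_right_mono) simp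
      ultimately show "exp (- \<kappa> * (real (card {x \<in> {0..<n}. \<sigma> x = i}) - (v + \<rho>) * real n / lam)) \<le> exp (- (2 * c) * real n)"
        by (simp add: mult_ac)
    qed
    also have "\<dots> = (M * real q + 1) * exp (- (2 * c) * real n)" by (simp add: algebra_simps)
    also have "\<dots> \<le> exp (- c * real n)" by (rule exp_absorb_const[OF c nn(4)])
    finally show ?thesis by simp
  qed
  then show ?thesis using c by blast
qed

section \<open>Colour counts, choice of parameters and conclusion\<close>

lemma sum_sw_kernel_counts:
  "(\<Sum>\<tau> | \<tau> \<in> configs n q \<and> Q (\<lambda>j. card {x \<in> {0..<n}. \<tau> x = j}). sw_kernel n q p \<sigma> \<tau>)
    = col_exp p q (allowed_edges n \<sigma>) {0..<n} (\<lambda>m. of_bool (Q m))"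
proof -
  have "(\<Sum>\<tau> | \<tau> \<in> configs n q \<and> Q (\<lambda>j. card {x \<in> {0..<n}. \<tau> x = j}). sw_kernel n q p \<sigma> \<tau>)
    = (\<Sum>\<tau>\<in>configs n q. sw_kernel n q p \<sigma> \<tau> * of_bool (Q (\<lambda>j. card {x \<in> {0..<n}. \<tau> x = j})))"
    by (intro sum.mono_neutral_cong_left) auto
  then show ?thesis
    unfolding col_exp_def configs_def[symmetric] by (simp add: sw_kernel_eq)
qed

lemma sum_card_colours:
  assumes "\<tau> \<in> configs n q"
  shows "(\<Sum>j\<in>{0..<q}. card {x \<in> {0..<n}. \<tau> x = j}) = n"
proof -
  have "\<tau> ` {0..<n} \<subseteq> {0..<q}" using assms by (auto simp: configs_def)
  then have "(\<Sum>j\<in>{0..<q}. \<Sum>x | x \<in> {0..<n} \<and> \<tau> x = j. 1) = (\<Sum>x\<in>{0..<n}. 1 :: nat)"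
    by (intro sum.group) auto
  then show ?thesis by simp
qed

lemma card_majority_colour:
  assumes \<tau>: "\<tau> \<in> configs n q" and c: "c < q"
    and b: "\<And>j. j < q \<Longrightarrow> j \<noteq> c \<Longrightarrow> real (card {x \<in> {0..<n}. \<tau> x = j}) \<le> b"
  shows "real n - (real q - 1) * b \<le> real (card {x \<in> {0..<n}. \<tau> x = c})"
proof -
  let ?n = "\<lambda>j. real (card {x \<in> {0..<n}. \<tau> x = j})"
  have "real n = (\<Sum>j\<in>{0..<q}. ?n j)" using sum_card_colours[OF \<tau>] by (metis of_nat_sum)
  also have "\<dots> = ?n c + (\<Sum>j\<in>{0..<q} - {c}. ?n j)" using c by (intro sum.remove) auto
  also have "(\<Sum>j\<in>{0..<q} - {c}. ?n j) \<le> real (card ({0..<q} - {c})) * b"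
    using b by (intro sum_bounded_above) auto
  also have "real (card ({0..<q} - {c})) = real q - 1" using c by (simp add: of_nat_diff)
  finally show ?thesis by simp
qed

text \<open>Serves to show that the disordered trap is inhabited, by the colouring x mod q; the 1 is
  the rounding error.\<close>

lemma card_residue_class_le:
  assumes "q > 0"
  shows "card {x \<in> {0..<n}. x mod q = j} \<le> n div q + 1"
proof -
  have "inj_on (\<lambda>x. x div q) {x \<in> {0..<n}. x mod q = j}"
  proof (rule inj_onI)
    fix x y assume "x \<in> {x \<in> {0..<n}. x mod q = j}" "y \<in> {x \<in> {0..<n}. x mod q = j}" "x div q = y div q"
    then show "x = y" using div_mult_mod_eq[of x q] div_mult_mod_eq[of y q] by simp
  qed
  moreover have "(\<lambda>x. x div q) ` {x \<in> {0..<n}. x mod q = j} \<subseteq> {..n div q}"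
    by (auto intro: div_le_mono)
  ultimately have "card {x \<in> {0..<n}. x mod q = j} \<le> card {..n div q}"
    by (intro card_inj_on_le[of "\<lambda>x. x div q"]) auto
  then show ?thesis by simp
qed

text \<open>The parametrization by \<open>v\<close> comes from writing the largest colour class as \<open>(v + \<rho>) n / \<lambda>\<close>, of which the
  giant component occupies \<open>v n / \<lambda>\<close>. Equality in \<open>\<rho> \<ge> v / (exp v - 1)\<close> is the fixed-point equation for
  the giant, and \<open>v + q \<rho> < \<lambda>\<close> says that after recolouring the class has grown.\<close>

lemma ordered_parameters:
  assumes q: "q \<ge> 2" and lam: "lambda_s q < lam" "lam < real q"
  obtains v \<rho> \<delta> :: real where "0 < v" "0 < \<delta>" "0 < \<rho>" "\<rho> < 1" "v < (\<rho> - \<delta>) * (exp v - 1)"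
    "v + real q * (\<rho> + \<delta>) < lam" "1 \<le> v + \<rho> + \<delta>"
proof -
  obtain v where v: "v > 0" and vl: "v + real q * v / (exp v - 1) < lam"
  proof (rule ccontr)
    assume no: "\<not> thesis"
    have "lam \<le> (INF z\<in>{0<..}. z + real q * z / (exp z - 1))"
    proof (rule cINF_greatest)
      fix z :: real assume "z \<in> {0<..}"
      then show "lam \<le> z + real q * z / (exp z - 1)" using no that[of z] by force
    qed auto
    then show False using lam by (simp add: lambda_s_def)
  qed
  define g where "g = v / (exp v - 1)"
  have ev: "exp v - 1 > v"
  proof -
    have "1 + v + v\<^sup>2 / 2 \<le> exp v" using v by (intro exp_lower_Taylor_quadratic) auto
    moreover have "v\<^sup>2 > 0" using v by simp
    ultimately show ?thesis by linarith
  qed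
  have g: "0 < g" "g < 1" using v ev by (auto simp: g_def)
  have vg: "v + real q * g < lam" using vl by (simp add: g_def)
  \<comment> \<open>With \<rho> = g + 2 \<delta>, the first bound keeps \<rho> below 1, and the
    second leaves room for q (\<rho> + \<delta>) = q g + 3 q \<delta>.\<close>
  define \<delta> where "\<delta> = min ((1 - g) / 4) ((lam - v - real q * g) / (4 * real q))"
  have \<delta>: "0 < \<delta>" using g vg q by (simp add: \<delta>_def)
  have \<delta>1: "\<delta> \<le> (1 - g) / 4" unfolding \<delta>_def by (rule min.cobounded1)
  have \<delta>2: "\<delta> \<le> (lam - v - real q * g) / (4 * real q)" unfolding \<delta>_def by (rule min.cobounded2)
  have \<delta>3: "4 * (real q * \<delta>) \<le> lam - v - real q * g"
    using mult_left_mono[OF \<delta>2, of "4 * real q"] q by simp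
  have qd: "real q * \<delta> > 0" using q \<delta> by simp
  show thesis
  proof (rule that[of v \<delta> "g + 2 * \<delta>"])
    show "g + 2 * \<delta> < 1" using \<delta>1 g by argo
    have "g * (exp v - 1) = v" using ev v by (simp add: g_def)
    moreover have "\<delta> * (exp v - 1) > 0" using \<delta> ev v by (intro mult_pos_pos) auto
    ultimately show "v < (g + 2 * \<delta> - \<delta>) * (exp v - 1)" by (simp add: distrib_right)
    show "v + real q * (g + 2 * \<delta> + \<delta>) < lam" using \<delta>3 qd by (simp add: distrib_left)
    \<comment> \<open>This shows v + g to be at least 1: a class that carries a giant has density at
      least 1, which later separates the two traps.\<close>
    have "1 - v \<le> exp (- v)" using exp_ge_add_one_self[of "- v"] by simp
    then have "(1 - v) * exp v \<le> exp (- v) * exp v" by (intro mult_right_mono) auto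
    then have "(1 - v) * (exp v - 1) \<le> v" by (simp add: exp_add[symmetric] algebra_simps)
    then have "1 - v \<le> g" using ev v by (simp add: g_def pos_le_divide_eq)
    then show "1 \<le> v + (g + 2 * \<delta>) + \<delta>" using \<delta> by linarith
  qed (use v \<delta> g in auto)
qed

theorem theorem1:
  fixes q :: nat and lam :: real
  assumes "q \<ge> 3"
    and "lambda_s q < lam" and "lam < lambda_S q"
  shows "\<exists>c>0. \<exists>N. \<forall>n\<ge>N.
           ereal (exp (c * real n)) \<le>
           ereal_of_enat (mixing_time (configs n q) (sw_kernel n q (lam / real n))
                            (potts n q (beta_of lam n)))"
proof -
  have q: "2 \<le> q" and lq: "lam < real q" using assms by (auto simp: lambda_S_def)
  obtain v \<rho> \<delta> :: real where v: "0 < v" and \<delta>: "0 < \<delta>" and \<rho>: "0 < \<rho>" "\<rho> < 1" "v < (\<rho> - \<delta>) * (exp v - 1)"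
    and grow: "v + real q * (\<rho> + \<delta>) < lam" and one: "1 \<le> v + \<rho> + \<delta>"
    using ordered_parameters[OF q assms(2) lq] .
  have q1: "1 * (\<rho> + \<delta>) \<le> real q * (\<rho> + \<delta>)" using q \<rho> \<delta> by (intro mult_right_mono) auto
  have s0: "v + \<rho> + \<delta> < lam" using add_left_mono[OF q1, of v] grow by simp
  have lam: "0 < lam" "v < lam" using s0 v \<rho> \<delta> by linarith+
  \<comment> \<open>The midpoint between 1 / q and 1 / lam.\<close>
  define b where "b = (1 / real q + 1 / lam) / 2"
  have b: "1 / real q < b" "lam * b < 1" using lq lam q by (auto simp: b_def field_simps)
  \<comment> \<open>If q - 1 classes have at most b' n vertices, exactly the required (v + \<rho> +
    \<delta>) n / lam are guaranteed for the remaining one.\<close>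
  define b' where "b' = (1 - (v + \<rho> + \<delta>) / lam) / (real q - 1)"
  have b'q: "(real q - 1) * b' = 1 - (v + \<rho> + \<delta>) / lam" using q by (simp add: b'_def)
  have b'0: "0 \<le> b'" using s0 lam q by (simp add: b'_def)
  have b'1: "lam * b' < 1"
  proof -
    have "(real q - 1) * (lam * b') = lam - (v + \<rho> + \<delta>)" using b'q lam by (simp add: field_simps)
    also have "\<dots> < (real q - 1) * 1" using one lq by simp
    finally show ?thesis using q by (simp add: mult_less_cancel_left)
  qed
  have b'2: "(1 - v / lam) / real q < b'"
  proof -
    \<comment> \<open>This is \<open>grow\<close> rearranged; dividing by the positive factors gives
      the claim.\<close>
    have "(real q - 1) * (lam - v) < real q * (lam - (v + \<rho> + \<delta>))" using grow by (simp add: algebra_simps)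
    then have "lam * ((real q - 1) * (1 - v / lam)) < lam * (real q * ((real q - 1) * b'))"
    proof -
      have "lam * (1 - x / lam) = lam - x" for x using lam by (simp add: right_diff_distrib)
      then have "lam * ((real q - 1) * (1 - v / lam)) = (real q - 1) * (lam - v)"
        "lam * (real q * (1 - (v + \<rho> + \<delta>) / lam)) = real q * (lam - (v + \<rho> + \<delta>))"
        by (simp_all only: mult.left_commute[of lam])
      then show ?thesis unfolding b'q using \<open>(real q - 1) * (lam - v) < real q * (lam - (v + \<rho> + \<delta>))\<close> by (simp only:)
    qed
    then have "(real q - 1) * (1 - v / lam) < real q * ((real q - 1) * b')"
      using lam(1) by (simp only: mult_less_cancel_left_pos)
    also have "\<dots> = (real q - 1) * (real q * b')" by (rule mult.left_commute)
    finally have "(real q - 1) * (1 - v / lam) < (real q - 1) * (real q * b')" .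
    moreover have "0 < real q - 1" using q by simp
    ultimately have "1 - v / lam < real q * b'" by (simp only: mult_less_cancel_left_pos)
    then show ?thesis using q by (simp add: field_simps)
  qed
  obtain c1 N1 where c1: "c1 > 0" and dis: "\<And>n \<sigma>. n \<ge> N1 \<Longrightarrow>
      (\<forall>x<n. real (card {y \<in> {0..<n}. \<sigma> y = \<sigma> x}) \<le> b * real n) \<Longrightarrow>
      col_exp (lam / real n) q (allowed_edges n \<sigma>) {0..<n} (\<lambda>m. of_bool (\<exists>j<q. b * real n < real (m j)))
      \<le> exp (- c1 * real n)"
    using disordered_trap[OF lam(1) q b] by blast
  obtain c2 N2 where c2: "c2 > 0" and ord: "\<And>n \<sigma> i. n \<ge> N2 \<Longrightarrow>
      (\<forall>x<n. \<sigma> x \<noteq> i \<longrightarrow> real (card {y \<in> {0..<n}. \<sigma> y = \<sigma> x}) \<le> b' * real n) \<and>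
      (v + \<rho> + \<delta>) * real n \<le> lam * real (card {y \<in> {0..<n}. \<sigma> y = i}) \<Longrightarrow>
      col_exp (lam / real n) q (allowed_edges n \<sigma>) {0..<n} (\<lambda>m. of_bool (no_majority q (b' * real n) m))
      \<le> exp (- c2 * real n)"
    using ordered_trap[OF lam(1) q v lam(2) \<rho>(3,1,2) \<delta> b'2 b'1] by blast
  \<comment> \<open>Both traps are left with probability at most exp (- 2 c n); the spare half of
    the rate absorbs the factor 4 from the trap bound.\<close>
  define c where "c = min c1 c2 / 2"
  have c: "c > 0" using c1 c2 by (simp add: c_def)
  define N where "N = max (max N1 N2) (max (max 1 (nat \<lceil>lam\<rceil>)) (max (nat \<lceil>4 / c\<rceil>) (nat \<lceil>1 / (b - 1 / real q)\<rceil>)))"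
  have "ereal (exp (c * real n)) \<le> ereal_of_enat (mixing_time (configs n q) (sw_kernel n q (lam / real n))
      (potts n q (beta_of lam n)))" if n: "n \<ge> N" for n
  proof -
    have nn: "n \<ge> N1" "n \<ge> N2" "n \<ge> 1" "real n \<ge> lam" "real n \<ge> 4 / c" "real n \<ge> 1 / (b - 1 / real q)"
      using n unfolding N_def by linarith+
    let ?p = "lam / real n"
    have p: "0 \<le> ?p" "?p \<le> 1" using lam nn by (auto simp: field_simps)
    let ?S = "configs n q"
    let ?n = "\<lambda>\<tau> j. card {x \<in> {0..<n}. \<tau> x = j}"
    define \<epsilon> where "\<epsilon> = exp (- (2 * c) * real n)"
    define A where "A = {\<tau> \<in> ?S. \<forall>j<q. real (?n \<tau> j) \<le> b * real n}"
    define B where "B = {\<tau> \<in> ?S. \<not> no_majority q (b' * real n) (?n \<tau>)}"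
    have col: "\<sigma> x < q" if "\<sigma> \<in> ?S" "x < n" for \<sigma> x using that by (auto simp: configs_def)
    have majority: "\<exists>i<q. (\<forall>j<q. j \<noteq> i \<longrightarrow> real (?n \<sigma> j) \<le> b' * real n) \<and>
        (v + \<rho> + \<delta>) * real n \<le> lam * real (?n \<sigma> i)" if \<sigma>: "\<sigma> \<in> B" for \<sigma>
    proof -
      obtain i where i: "i < q" "\<And>j. j < q \<Longrightarrow> j \<noteq> i \<Longrightarrow> real (?n \<sigma> j) \<le> b' * real n"
        using \<sigma> by (force simp: B_def no_majority_def)
      have "real n - (real q - 1) * (b' * real n) \<le> real (?n \<sigma> i)"
        by (rule card_majority_colour) (use \<sigma> i in \<open>auto simp: B_def\<close>)
      also have "real n - (real q - 1) * (b' * real n) = (1 - (real q - 1) * b') * real n"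
        by (simp add: algebra_simps)
      finally have "(v + \<rho> + \<delta>) / lam * real n \<le> real (?n \<sigma> i)" unfolding b'q by simp
      then show ?thesis using i lam by (auto simp: field_simps)
    qed
    have "ereal (1 / (4 * \<epsilon>)) \<le> ereal_of_enat (mixing_time ?S (sw_kernel n q ?p) (potts n q (beta_of lam n)))"
    proof (rule mixing_time_two_traps[where A = A and B = B])
      \<comment> \<open>A dominant class has at least n / lam vertices, whereas the classes in A
        have at most b n, which is less.\<close>
      show "A \<inter> B = {}"
      proof (rule equals0I)
        fix \<tau> assume \<tau>: "\<tau> \<in> A \<inter> B"
        then obtain i where i: "i < q" "(v + \<rho> + \<delta>) * real n \<le> lam * real (?n \<tau> i)"
          using majority[of \<tau>] by auto
        have "lam * real (?n \<tau> i) \<le> lam * (b * real n)"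
          using \<tau> i lam by (intro mult_left_mono) (auto simp: A_def)
        moreover have "lam * b * real n < 1 * real n" using b nn by (intro mult_strict_right_mono) auto
        moreover have "1 * real n \<le> (v + \<rho> + \<delta>) * real n" using one by (intro mult_right_mono) auto
        ultimately show False using i by simp
      qed
      have "restrict (\<lambda>x. x mod q) {0..<n} \<in> A"
        unfolding A_def
      proof (intro CollectI conjI allI impI)
        show "restrict (\<lambda>x. x mod q) {0..<n} \<in> ?S" using q by (auto simp: configs_def)
        fix j assume "j < q"
        have "{x \<in> {0..<n}. restrict (\<lambda>x. x mod q) {0..<n} x = j} = {x \<in> {0..<n}. x mod q = j}" by auto
        then have "?n (restrict (\<lambda>x. x mod q) {0..<n}) j \<le> n div q + 1"
          using card_residue_class_le[of q n j] q by simp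
        then have "real (?n (restrict (\<lambda>x. x mod q) {0..<n}) j) \<le> real (n div q) + 1" by linarith
        also have "real (n div q) \<le> real n / real q" by (rule of_nat_div_le_of_nat)
        also have "real n / real q + 1 \<le> b * real n"
          using nn(6) b(1) by (simp add: field_simps)
        finally show "real (?n (restrict (\<lambda>x. x mod q) {0..<n}) j) \<le> b * real n" by simp
      qed
      then show "A \<noteq> {}" by blast
      have "restrict (\<lambda>_. 0) {0..<n} \<in> B"
      proof -
        define m where "m = ?n (restrict (\<lambda>_. 0 :: nat) {0..<n})"
        have m: "m j = 0" if "j \<noteq> 0" for j
        proof -
          have "{x \<in> {0..<n}. restrict (\<lambda>_. 0) {0..<n} x = j} = {}" using that by auto
          then show ?thesis unfolding m_def by (simp only: card.empty)
        qed
        have "\<not> b' * real n < real (m j)" if "j \<noteq> 0" for j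
          using m[OF that] b'0 by (simp add: mult_less_0_iff)
        moreover have "0 < q" using q by simp
        ultimately have "\<not> no_majority q (b' * real n) m" unfolding no_majority_def by blast
        moreover have "restrict (\<lambda>_. 0) {0..<n} \<in> ?S" using q by (simp add: configs_def restrict_PiE_iff)
        ultimately show ?thesis unfolding B_def m_def mem_Collect_eq by (intro conjI)
      qed
      then show "B \<noteq> {}" by blast
      show "0 \<le> sw_kernel n q ?p \<sigma> \<tau>" if "\<tau> \<in> ?S" for \<sigma> \<tau>
        using that p by (simp add: sw_kernel_eq rc_kernel_nonneg)
      show "(\<Sum>\<tau>\<in>?S. sw_kernel n q ?p \<sigma> \<tau>) = 1" for \<sigma>
        using sum_sw_kernel_counts[of n q ?p \<sigma> "\<lambda>_. True"] q by (simp add: col_exp_one)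
      show "(\<Sum>\<tau>\<in>?S. potts n q (beta_of lam n) \<tau>) = 1" using q by (intro sum_potts) auto
      show "(\<Sum>\<tau>\<in>?S - A. sw_kernel n q ?p \<sigma> \<tau>) \<le> \<epsilon>" if \<sigma>: "\<sigma> \<in> A" for \<sigma>
      proof -
        have "?S - A = {\<tau>. \<tau> \<in> ?S \<and> (\<exists>j<q. b * real n < real (?n \<tau> j))}" by (auto simp: A_def not_le)
        then have "(\<Sum>\<tau>\<in>?S - A. sw_kernel n q ?p \<sigma> \<tau>) =
            col_exp ?p q (allowed_edges n \<sigma>) {0..<n} (\<lambda>m. of_bool (\<exists>j<q. b * real n < real (m j)))"
          using sum_sw_kernel_counts[of n q ?p \<sigma> "\<lambda>m. \<exists>j<q. b * real n < real (m j)"] by simp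
        also have "\<dots> \<le> exp (- c1 * real n)"
          by (rule dis[OF nn(1)]) (use \<sigma> col[of \<sigma>] in \<open>auto simp: A_def\<close>)
        also have "\<dots> \<le> \<epsilon>" unfolding \<epsilon>_def by (simp add: c_def mult_right_mono)
        finally show ?thesis .
      qed
      show "(\<Sum>\<tau>\<in>?S - B. sw_kernel n q ?p \<sigma> \<tau>) \<le> \<epsilon>" if \<sigma>: "\<sigma> \<in> B" for \<sigma>
      proof -
        obtain i where i: "i < q" "\<And>j. j < q \<Longrightarrow> j \<noteq> i \<Longrightarrow> real (?n \<sigma> j) \<le> b' * real n"
          "(v + \<rho> + \<delta>) * real n \<le> lam * real (?n \<sigma> i)" using majority[OF \<sigma>] by blast
        have \<sigma>S: "\<sigma> \<in> ?S" using \<sigma> by (simp add: B_def)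
        have "?S - B = {\<tau>. \<tau> \<in> ?S \<and> no_majority q (b' * real n) (?n \<tau>)}" by (auto simp: B_def)
        then have "(\<Sum>\<tau>\<in>?S - B. sw_kernel n q ?p \<sigma> \<tau>) =
            col_exp ?p q (allowed_edges n \<sigma>) {0..<n} (\<lambda>m. of_bool (no_majority q (b' * real n) m))"
          using sum_sw_kernel_counts[of n q ?p \<sigma> "no_majority q (b' * real n)"] by simp
        also have "\<dots> \<le> exp (- c2 * real n)"
          by (rule ord[OF nn(2), of \<sigma> i]) (use i col[OF \<sigma>S] in auto)
        also have "\<dots> \<le> \<epsilon>" unfolding \<epsilon>_def by (simp add: c_def mult_right_mono)
        finally show ?thesis .
      qed
      show "0 < \<epsilon>" by (simp add: \<epsilon>_def)
    qed (auto simp: A_def B_def potts_nonneg)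
    moreover have "exp (c * real n) \<le> 1 / (4 * \<epsilon>)"
      using exp_absorb_const[OF c nn(5)] unfolding \<epsilon>_def
      by (simp add: exp_minus field_simps)
    ultimately show ?thesis by (meson ereal_less_eq(3) order_trans)
  qed
  then show ?thesis using c by blast
qed

end
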